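(* Let $(X_j)_{j\in\mathbb N}$ be the generic waiting-time sequence of a Crump-Mode-Jagers process $(\mathscr T_t)_{t\ge 0}$ as described in the context, let $(X'_j)_{j\in\mathbb N}$ be an independent copy of $(X_j)_{j\in\mathbb N}$, and assume Assumption (A) holds. Then, for the sequence of directed trees $(\mathscr T_{\tau_n})_{n\in\mathbb N_0}$: \begin{enumerate} \item If the series $\sum_{i=1}^\infty (X_i-X'_i)$ diverges almost surely, then almost surely $(\mathscr T_{\tau_n})_{n\in\mathbb N_0}$ does not contain a persistent hub. \item Suppose that for some $\alpha>0$ and $K\in\mathbb N$, \[\sum_{j=1}^\infty \mathbb E\Big[e^{-\alpha\sum_{i=1}^j X_i}\Big]<1 \quad\text{and}\quad \prod_{i=K+1}^\infty \mathbb E\Big[e^{\alpha(X'_i-X_i)}\Big]<\infty.\] Then almost surely $(\mathscr T_{\tau_n})_{n\in\mathbb N_0}$ contains a persistent hub. \end{enumerate}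
   Context: Ulam–Harris tree: $\mathcal U=\bigcup_{n\ge0}\mathbb N^n$ with $\mathbb N^0=\{\varnothing\}$ (the root); an element $u=(u_1,\dots,u_k)\in\mathbb N^k$ is written $u=u_1\cdots u_k$, $|u|=k$, and $uj$ denotes the $j$-th child of $u$. Let $(X_j)_{j\in\mathbb N}$ be a sequence of $[0,\infty]$-valued random variables and, for each $u\in\mathcal U$, let $(X(uj))_{j\in\mathbb N}$ be a copy of $(X_j)_{j\in\mathbb N}$, these sequences being independent over different $u$. Birth times are defined recursively by $\mathcal B(\varnothing)=0$ and $\mathcal B(ui)=\mathcal B(u)+\sum_{j=1}^i X(uj)$. For $t\in[0,\infty]$ set $\mathscr T_t=\{x\in\mathcal U:\mathcal B(x)\le t\}$, viewed as a directed tree with edges directed from each individual to its children, and set $\tau_k=\inf\{t\ge0:|\mathscr T_t|\ge k\}$. For a directed tree $T$, $\deg^+(u,T)$ is the out-degree of $u$ in $T$, with the convention $\deg^+(u,T)=-\infty$ if $u\notin T$. For a sequence of directed trees $(\mathcal T_n)_{n\in\mathbb N_0}$, a node $u\in\bigcup_n\mathcal T_n$ is a persistent hub if $\deg^+(u,\mathcal T_n)=\max_{v\in\mathcal T_n}\deg^+(v,\mathcal T_n)$ for all but finitely many $n$; the sequence contains a persistent hub if such a $u$ exists. Assumption (A): (i) the random variables $(X_i)_{i\in\mathbb N}$ are mutually independent; (ii) for each $j$, $X_j<\infty$ almost surely; (iii) $\sum_{j=1}^\infty\prod_{i=1}^j\mathbb P(X_i=0)<1$. *)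

theory Defs
  imports "HOL-Probability.Probability"
begin

text \<open>Ulam--Harris nodes are lists of naturals (root = []); the j-th child of u
  is u @ [j], with children indexed from 0 (child index 0 is the paper's first child).
  A realisation of the waiting times is Y :: nat list => nat => ennreal,
  Y u j being the paper's X(u(j+1)).\<close>

definition birth :: "(nat list \<Rightarrow> nat \<Rightarrow> ennreal) \<Rightarrow> nat list \<Rightarrow> ennreal" where
  "birth Y u = (\<Sum>k<length u. \<Sum>j\<le>u ! k. Y (take k u) j)"

definition cmj_tree :: "(nat list \<Rightarrow> nat \<Rightarrow> ennreal) \<Rightarrow> ennreal \<Rightarrow> nat list set" where
  "cmj_tree Y t = {x. birth Y x \<le> t}"

definition cmj_tau :: "(nat list \<Rightarrow> nat \<Rightarrow> ennreal) \<Rightarrow> nat \<Rightarrow> ennreal" where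
  "cmj_tau Y k = Inf {t. infinite (cmj_tree Y t) \<or> k \<le> card (cmj_tree Y t)}"

definition outdeg :: "nat list \<Rightarrow> nat list set \<Rightarrow> ereal" where
  "outdeg u T = (if u \<notin> T then -\<infinity>
     else if finite {j. u @ [j] \<in> T} then ereal (real (card {j. u @ [j] \<in> T})) else \<infinity>)"

definition has_max_outdeg :: "nat list \<Rightarrow> nat list set \<Rightarrow> bool" where
  "has_max_outdeg u T \<longleftrightarrow> outdeg u T \<in> (\<lambda>v. outdeg v T) ` T \<and> (\<forall>v\<in>T. outdeg v T \<le> outdeg u T)"

definition persistent_hub :: "(nat \<Rightarrow> nat list set) \<Rightarrow> nat list \<Rightarrow> bool" where
  "persistent_hub Ts u \<longleftrightarrow> u \<in> (\<Union>n. Ts n) \<and> (\<forall>\<^sub>F n in sequentially. has_max_outdeg u (Ts n))"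

definition has_persistent_hub :: "(nat \<Rightarrow> nat list set) \<Rightarrow> bool" where
  "has_persistent_hub Ts \<longleftrightarrow> (\<exists>u. persistent_hub Ts u)"

end

theory Submission
  imports Defs
begin

text \<open>The \<open>n\<close>-th child of \<open>u\<close> is born before that of \<open>v\<close> depending on the sign of \<open>B(u) - B(v) + W\<^sub>n\<close>, where
  \<open>W\<^sub>n = \<Sum>\<^sub>i\<^sub>\<le>\<^sub>n (X(ui) - X(vi))\<close> is a walk with independent symmetric increments.

  If the series diverges, then \<open>W\<close> is almost surely unbounded in both directions, so every two nodes overtake
  each other infinitely often before explosion. Explosion does not help either: for each \<open>m\<close>, the subtree in
  which every node keeps only its first \<open>m\<close> children is subcritical on a short time scale by (A)(iii), hence
  finite at finite times, so the degrees are unbounded in the exploding tree while each node has finite degree.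

  Under the moment conditions, \<open>E \<Sum>\<^sub>u e^(-\<alpha> B(u))\<close> is a convergent geometric series, so the process does not
  explode, and a maximal inequality for \<open>W\<close> with Borel-Cantelli shows that only finitely many nodes ever
  overtake the root after its \<open>K\<close>-th child. Any two of these are eventually ordered since \<open>W\<close> converges and
  ties \<open>B(u) - B(v) + W\<^sub>n \<longrightarrow> 0\<close> occur only if the difference is eventually 0; the least one is a hub.

  Both tools for symmetric walks, the maximal inequality and the exclusion of ties, come from the invariance of
  the law under flipping the signs of all increments after a stopping time.\<close>

section \<open>Deterministic criteria\<close>

text \<open>The walk and its start B(u) - B(v) are dependent when one node is an ancestor of the
  other, since B(u) then contains waiting times of v. So a walk is cut at an index beyond the
  waiting times that cause this, and all that comes before is lumped into one initial term
  \<open>D 0\<close>, independent of the later increments but not symmetric. This is why the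
  reflection lemmas ask for symmetry only from some index on.

  Against the root, the bounds must also be summable over all nodes. For this the early part of the
  root's own clock is replaced by a constant, and the exponential moment of the walk splits into a
  bounded product of factors E e^(\<alpha>(X' - X)) and a product of Laplace transforms along the
  ancestral line.

  Truncation to m children is forced by a limit: E e^(-\<beta> X) tends to P(X = 0) as \<beta>
  grows, but under (A) alone the sum over all children may be infinite for every \<beta>, so the
  limit is only taken in finite sums.

  Randomness enters through two pathwise criteria, whose hypotheses reduce to countably many almost
  sure statements about nodes, pairs of nodes and integer times.\<close>

definition rbirth :: "(nat list \<Rightarrow> nat \<Rightarrow> real) \<Rightarrow> nat list \<Rightarrow> real" where
  "rbirth y u = (\<Sum>k<length u. \<Sum>j\<le>u ! k. y (take k u) j)"

text \<open>\<open>kid y u n\<close> is the birth time of the \<open>n\<close>-th child of \<open>u\<close> counted from 1, that is, of \<open>u @ [n - 1]\<close>;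
  \<open>kid y u 0\<close> is the birth time of \<open>u\<close> itself.\<close>

definition kid :: "(nat list \<Rightarrow> nat \<Rightarrow> real) \<Rightarrow> nat list \<Rightarrow> nat \<Rightarrow> real" where
  "kid y u n = rbirth y u + (\<Sum>j<n. y u j)"

lemma rbirth_Nil [simp]: "rbirth y [] = 0"
  by (simp add: rbirth_def)

lemma rbirth_snoc: "rbirth y (u @ [j]) = kid y u (Suc j)"
proof -
  have "(\<Sum>k<length u. \<Sum>i\<le>(u @ [j]) ! k. y (take k (u @ [j])) i) = rbirth y u"
    unfolding rbirth_def by (intro sum.cong) (auto simp: nth_append)
  then show ?thesis
    by (simp add: rbirth_def[of y "u @ [j]"] kid_def lessThan_Suc_atMost[symmetric])
qed

lemma birth_ennreal:
  assumes "\<And>u j. 0 \<le> y u j"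
  shows "birth (\<lambda>u j. ennreal (y u j)) u = ennreal (rbirth y u)"
  using assms by (simp add: birth_def rbirth_def sum_nonneg)

lemma outdeg_mono:
  assumes "u \<in> T" "{j. v @ [j] \<in> T} \<subseteq> {j. u @ [j] \<in> T}"
  shows "outdeg v T \<le> outdeg u T"
  using assms by (auto simp: outdeg_def intro: card_mono finite_subset)

lemma finite_total_preorder_has_least:
  assumes "finite A" "A \<noteq> {}"
    and total: "\<And>a b. R a b \<or> R b a" and trans: "\<And>a b c. R a b \<Longrightarrow> R b c \<Longrightarrow> R a c"
  shows "\<exists>a\<in>A. \<forall>b\<in>A. R a b"
  using assms(1,2)
proof (induction A rule: finite_ne_induct)
  case (singleton x) then show ?case using total by blast
next
  case (insert x A) then show ?case using total trans by (metis insert_iff)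
qed

section \<open>Growth of the tree for one fixed realisation with real waiting times\<close>

context
  fixes y :: "nat list \<Rightarrow> nat \<Rightarrow> real"
  assumes y_nonneg: "\<And>u j. 0 \<le> y u j"
begin

lemma rbirth_nonneg: "0 \<le> rbirth y u"
  using y_nonneg by (auto simp: rbirth_def intro!: sum_nonneg)

lemma kid_mono: "m \<le> n \<Longrightarrow> kid y u m \<le> kid y u n"
  unfolding kid_def using y_nonneg by (auto intro!: sum_mono2)

lemma rbirth_le_kid: "rbirth y u \<le> kid y u n"
  using kid_mono[of 0 n u] by (simp add: kid_def)

lemma rbirth_prefix_le: "rbirth y u \<le> rbirth y (u @ v)"
proof (induction v rule: rev_induct)
  case (snoc j v)
  then show ?case
    using rbirth_le_kid[of "u @ v" "Suc j"] rbirth_snoc[of y "u @ v" j] by simp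
qed simp

abbreviation "Y \<equiv> (\<lambda>u j. ennreal (y u j))"

lemma mem_cmj_tree: "0 \<le> t \<Longrightarrow> u \<in> cmj_tree Y (ennreal t) \<longleftrightarrow> rbirth y u \<le> t"
  by (simp add: cmj_tree_def birth_ennreal y_nonneg)

lemma cmj_tree_mono: "s \<le> t \<Longrightarrow> cmj_tree Y s \<subseteq> cmj_tree Y t"
  by (auto simp: cmj_tree_def)

lemma cmj_tree_snoc_mono:
  assumes "u @ [j] \<in> cmj_tree Y t" "i \<le> j"
  shows "u @ [i] \<in> cmj_tree Y t"
  using assms kid_mono[of "Suc i" "Suc j" u]
  by (auto simp: cmj_tree_def birth_ennreal y_nonneg rbirth_snoc elim!: order_trans[rotated] intro!: ennreal_leI)

lemma cmj_tree_prefix: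
  assumes "u @ v \<in> cmj_tree Y t" shows "u \<in> cmj_tree Y t"
  using assms rbirth_prefix_le[of u v]
  by (auto simp: cmj_tree_def birth_ennreal y_nonneg elim!: order_trans[rotated] intro!: ennreal_leI)

lemma le_cmj_tau:
  assumes "finite (cmj_tree Y t)" "card (cmj_tree Y t) < n"
  shows "t \<le> cmj_tau Y n"
  unfolding cmj_tau_def
proof (intro Inf_greatest, rule ccontr)
  fix s assume s: "s \<in> {t. infinite (cmj_tree Y t) \<or> n \<le> card (cmj_tree Y t)}" "\<not> t \<le> s"
  then have sub: "cmj_tree Y s \<subseteq> cmj_tree Y t" by (intro cmj_tree_mono) auto
  with assms have "finite (cmj_tree Y s)" "card (cmj_tree Y s) < n"
    using finite_subset[OF sub] card_mono[OF assms(1) sub] by auto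
  with s show False by auto
qed

text \<open>Before the birth of \<open>w\<close> the tree lacks \<open>w\<close>, hence is strictly
  smaller. The hub property is only known at the times \<open>cmj_tau Y n\<close>; this makes every
  birth time with a finite tree one of them, also when several births coincide.\<close>

lemma cmj_tau_at_birth:
  assumes fin: "finite (cmj_tree Y (birth Y w))"
  shows "cmj_tau Y (card (cmj_tree Y (birth Y w))) = birth Y w"
proof (rule antisym)
  show "cmj_tau Y (card (cmj_tree Y (birth Y w))) \<le> birth Y w"
    unfolding cmj_tau_def by (intro Inf_lower) auto
  show "birth Y w \<le> cmj_tau Y (card (cmj_tree Y (birth Y w)))"
    unfolding cmj_tau_def
  proof (intro Inf_greatest, rule ccontr)
    fix s assume s: "s \<in> {t. infinite (cmj_tree Y t) \<or> card (cmj_tree Y (birth Y w)) \<le> card (cmj_tree Y t)}"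
      "\<not> birth Y w \<le> s"
    then have "cmj_tree Y s \<subset> cmj_tree Y (birth Y w)"
      by (auto simp: cmj_tree_def)
    with fin have "finite (cmj_tree Y s)" "card (cmj_tree Y s) < card (cmj_tree Y (birth Y w))"
      by (auto intro: finite_subset psubset_card_mono)
    with s show False by auto
  qed
qed

lemma eventually_mem_cmj_tree_tau:
  assumes "\<And>t. finite {w. rbirth y w \<le> t}"
  shows "\<forall>\<^sub>F n in sequentially. w \<in> cmj_tree Y (cmj_tau Y n)"
  using eventually_gt_at_top[of "card (cmj_tree Y (birth Y w))"]
proof eventually_elim
  case (elim n)
  have "cmj_tree Y (birth Y w) = {v. rbirth y v \<le> rbirth y w}"
    by (auto simp: birth_ennreal y_nonneg mem_cmj_tree rbirth_nonneg)
  then have "birth Y w \<le> cmj_tau Y n"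
    using assms elim by (intro le_cmj_tau) auto
  then show ?case by (auto simp: cmj_tree_def)
qed

text \<open>The root is put among the candidates because it is never behind a node outside
  \<open>F\<close> from the \<open>K\<close>-th child on. A candidate that is eventually ahead of
  all candidates is therefore ahead of the root and, through the root, of every other node, with one
  threshold for all nodes.\<close>

lemma has_persistent_hub_if:
  assumes fin: "\<And>t. finite {w. rbirth y w \<le> t}"
    and F: "finite F"
    and dom: "\<And>u n. u \<notin> F \<Longrightarrow> K \<le> n \<Longrightarrow> kid y [] n \<le> kid y u n"
    and cmp: "\<And>u v. (\<forall>\<^sub>F n in sequentially. kid y u n \<le> kid y v n) \<or>
                     (\<forall>\<^sub>F n in sequentially. kid y v n \<le> kid y u n)"
  shows "has_persistent_hub (\<lambda>n. cmj_tree Y (cmj_tau Y n))"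
proof -
  define R where "R u v \<longleftrightarrow> (\<forall>\<^sub>F n in sequentially. kid y u n \<le> kid y v n)" for u v
  have "\<exists>u\<in>insert [] F. \<forall>v\<in>insert [] F. R u v"
  proof (rule finite_total_preorder_has_least)
    fix a b c assume "R a b" "R b c"
    then show "R a c" unfolding R_def by eventually_elim simp
  qed (use F cmp in \<open>auto simp: R_def\<close>)
  then obtain u where u: "\<And>v. v \<in> insert [] F \<Longrightarrow> R u v" by blast
  have "\<forall>\<^sub>F n in sequentially. \<forall>v\<in>insert [] F. kid y u n \<le> kid y v n"
    using u F by (auto simp: R_def eventually_ball_finite_distrib eventually_conj_iff)
  then obtain N where N: "\<And>n v. N \<le> n \<Longrightarrow> v \<in> insert [] F \<Longrightarrow> kid y u n \<le> kid y v n"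
    by (auto simp: eventually_sequentially)
  define N' where "N' = max N K"
  have le: "kid y u n \<le> kid y v n" if "N' \<le> n" for v n
  proof (cases "v \<in> insert [] F")
    case False
    then have "kid y u n \<le> kid y [] n" "kid y [] n \<le> kid y v n"
      using N[of n "[]"] dom[of v n] that by (auto simp: N'_def)
    then show ?thesis by simp
  qed (use N that in \<open>auto simp: N'_def\<close>)
  \<comment> \<open>Once \<open>u @ [N']\<close> is born, the children of \<open>u\<close> with
    index at most \<open>N'\<close> are all present, and only indices in the range where
    \<open>u\<close> is ahead of every node remain to be compared.\<close>
  have max: "has_max_outdeg u T" if T: "T = cmj_tree Y t" "u @ [N'] \<in> T" for T t
  proof -
    have uT: "u \<in> T" using cmj_tree_prefix T by blast
    have "outdeg v T \<le> outdeg u T" for v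
    proof (rule outdeg_mono[OF uT], safe)
      fix j assume j: "v @ [j] \<in> T"
      show "u @ [j] \<in> T"
      proof (cases "j \<le> N'")
        case True
        then show ?thesis using cmj_tree_snoc_mono T by blast
      next
        case False
        then have "rbirth y (u @ [j]) \<le> rbirth y (v @ [j])"
          using le[of "Suc j" v] by (simp add: rbirth_snoc)
        then show ?thesis
          using j T by (auto simp: cmj_tree_def birth_ennreal y_nonneg elim!: order_trans[rotated] intro!: ennreal_leI)
      qed
    qed
    then show ?thesis using uT by (auto simp: has_max_outdeg_def)
  qed
  have "\<forall>\<^sub>F n in sequentially. has_max_outdeg u (cmj_tree Y (cmj_tau Y n))"
    using eventually_mem_cmj_tree_tau[OF fin, of "u @ [N']"] by eventually_elim (use max in blast)
  moreover have "u \<in> (\<Union>n. cmj_tree Y (cmj_tau Y n))"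
    using eventually_mem_cmj_tree_tau[OF fin, of u] by (auto simp: eventually_sequentially)
  ultimately show ?thesis
    by (auto simp: has_persistent_hub_def persistent_hub_def)
qed

text \<open>A finite tree does not grow immediately: each of its finitely many nodes has a first unborn child.\<close>

lemma cmj_tree_right_continuous:
  assumes t: "0 \<le> t" and fin: "finite {w. rbirth y w \<le> t}"
  obtains s where "t < s" "{w. rbirth y w < s} \<subseteq> {w. rbirth y w \<le> t}"
proof -
  let ?T = "{w. rbirth y w \<le> t}"
  have "\<exists>d>t. \<forall>j. t < rbirth y (u @ [j]) \<longrightarrow> d \<le> rbirth y (u @ [j])" for u
  proof (cases "\<exists>j. t < rbirth y (u @ [j])")
    case True
    define i where "i = (LEAST j. t < rbirth y (u @ [j]))"
    have i: "t < rbirth y (u @ [i])" unfolding i_def using True by (metis LeastI)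
    have "rbirth y (u @ [i]) \<le> rbirth y (u @ [j])" if "t < rbirth y (u @ [j])" for j
    proof -
      have "i \<le> j" unfolding i_def using that by (rule Least_le)
      then show ?thesis by (simp add: rbirth_snoc kid_mono)
    qed
    with i show ?thesis by blast
  next
    case False
    then show ?thesis by (intro exI[of _ "t + 1"]) auto
  qed
  then obtain d where d: "\<And>u. t < d u" "\<And>u j. t < rbirth y (u @ [j]) \<Longrightarrow> d u \<le> rbirth y (u @ [j])"
    by metis
  define s where "s = Min (insert (t + 1) (d ` ?T))"
  have "t < s" unfolding s_def using fin d by (subst Min_gr_iff) auto
  \<comment> \<open>Induction along the ancestral line: the parent is born by \<open>t\<close>, so a
    child missing at \<open>t\<close> is born at \<open>d w\<close> or later, hence not before
    \<open>s\<close>.\<close>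
  moreover have "rbirth y w < s \<Longrightarrow> rbirth y w \<le> t" for w
  proof (induction w rule: rev_induct)
    case Nil then show ?case using t by simp
  next
    case (snoc j w)
    have "rbirth y w \<le> t" using snoc rbirth_prefix_le[of w "[j]"] by auto
    then have "s \<le> d w" unfolding s_def using fin by (intro Min_le) auto
    with d(2)[of w j] snoc.prems show ?case by fastforce
  qed
  ultimately show ?thesis using that by blast
qed

text \<open>The infimum defining \<open>cmj_tau\<close> is attained: with fewer than
  \<open>n\<close> nodes at that time, right-continuity would keep the same tree for a while longer
  and push the infimum up.\<close>

lemma card_cmj_tree_tau:
  assumes fin: "finite (cmj_tree Y (cmj_tau Y n))" and tau: "cmj_tau Y n < \<infinity>"
  shows "n \<le> card (cmj_tree Y (cmj_tau Y n))"
proof (rule ccontr)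
  assume less: "\<not> n \<le> card (cmj_tree Y (cmj_tau Y n))"
  obtain t where t: "0 \<le> t" "cmj_tau Y n = ennreal t"
    using tau by (cases "cmj_tau Y n") auto
  have eq: "cmj_tree Y (cmj_tau Y n) = {w. rbirth y w \<le> t}"
    using t by (auto simp: mem_cmj_tree)
  obtain s where s: "t < s" "{w. rbirth y w < s} \<subseteq> {w. rbirth y w \<le> t}"
    using cmj_tree_right_continuous[OF t(1)] fin eq by auto
  define r where "r = (t + s) / 2"
  have "cmj_tree Y (ennreal r) \<subseteq> cmj_tree Y (cmj_tau Y n)"
  proof
    fix w assume "w \<in> cmj_tree Y (ennreal r)"
    then have "rbirth y w < s" using s t(1) by (simp add: mem_cmj_tree r_def)
    then show "w \<in> cmj_tree Y (cmj_tau Y n)" using s eq by blast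
  qed
  then have "ennreal r \<le> cmj_tau Y n"
    using fin less card_mono[OF fin, of "cmj_tree Y (ennreal r)"]
    by (intro le_cmj_tau) (auto intro: finite_subset)
  then show False using s t by (auto simp: r_def)
qed

text \<open>The cases are explosion and non-explosion. Under explosion the degree of the alleged hub
  stays bounded, which would confine the growing trees to a finite truncated tree. Without explosion
  some other node gets a child before the hub gets its child of the same index, arbitrarily
  late.\<close>

lemma no_persistent_hub_if:
  assumes unb: "\<And>u v C. u \<noteq> v \<Longrightarrow> \<exists>n. C < (\<Sum>j<n. y u j - y v j)"
    and trunc: "\<And>m t. finite {w \<in> lists {..<m}. rbirth y w \<le> t}"
  shows "\<not> has_persistent_hub (\<lambda>n. cmj_tree Y (cmj_tau Y n))"
proof
  assume "has_persistent_hub (\<lambda>n. cmj_tree Y (cmj_tau Y n))"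
  then obtain u N where u: "\<And>n. N \<le> n \<Longrightarrow> has_max_outdeg u (cmj_tree Y (cmj_tau Y n))"
    by (auto simp: has_persistent_hub_def persistent_hub_def eventually_sequentially)
  show False
  proof (cases "\<exists>t\<ge>0. \<forall>n. cmj_tau Y n \<le> ennreal t")
    case True
    then obtain t where t: "0 \<le> t" "\<And>n. cmj_tau Y n \<le> ennreal t" by blast
    obtain v where "v \<noteq> u" using not_Cons_self[of undefined u] by blast
    \<comment> \<open>As the waiting times of \<open>v\<close> are nonnegative, an unbounded
      difference makes the partial sums of \<open>u\<close> alone exceed \<open>t\<close>; thus
      \<open>u\<close> has fewer than \<open>m\<close> children by time \<open>t\<close>.\<close>
    then obtain m where m: "t < (\<Sum>j<m. y u j - y v j)" using unb[of u v t] by metis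
    also have "\<dots> \<le> (\<Sum>j<m. y u j)" using y_nonneg by (intro sum_mono) auto
    also have "\<dots> \<le> kid y u m" by (simp add: kid_def rbirth_nonneg)
    finally have tm: "t < kid y u m" .
    let ?S = "{w \<in> lists {..<m}. rbirth y w \<le> t}"
    have sub: "cmj_tree Y (cmj_tau Y n) \<subseteq> ?S" if "N \<le> n" for n
    proof
      fix w assume w: "w \<in> cmj_tree Y (cmj_tau Y n)"
      let ?T = "cmj_tree Y (cmj_tau Y n)"
      have T: "v \<in> ?T \<Longrightarrow> rbirth y v \<le> t" for v
        using cmj_tree_mono[OF t(2)] mem_cmj_tree[OF t(1)] by blast
      have "{j. u @ [j] \<in> ?T} \<subseteq> {..<m}"
      proof (rule subsetI, rule ccontr)
        fix j assume "j \<in> {j. u @ [j] \<in> ?T}" "j \<notin> {..<m}"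
        then have "rbirth y (u @ [j]) \<le> t" "kid y u m \<le> kid y u (Suc j)"
          using T by (auto intro!: kid_mono)
        then show False using tm by (simp add: rbirth_snoc)
      qed
      then have "finite {j. u @ [j] \<in> ?T}" "card {j. u @ [j] \<in> ?T} \<le> m"
        using finite_subset[of _ "{..<m}"] card_mono[of "{..<m}"] by auto
      then have degu: "outdeg u ?T \<le> ereal (real m)"
        by (auto simp: outdeg_def)
      \<comment> \<open>The maximal degree is at most \<open>m\<close> and children appear in order,
        so all child indices in the tree are below \<open>m\<close>.\<close>
      have jm: "j < m" if v: "v @ [j] \<in> ?T" for v j
      proof -
        have vT: "v \<in> ?T" using v cmj_tree_prefix by blast
        then have "outdeg v ?T \<le> ereal (real m)"
          using u[OF \<open>N \<le> n\<close>] degu by (auto simp: has_max_outdeg_def intro: order_trans)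
        then have "finite {j. v @ [j] \<in> ?T}" "card {j. v @ [j] \<in> ?T} \<le> m"
          using vT by (auto simp: outdeg_def split: if_splits)
        moreover have "{..j} \<subseteq> {j. v @ [j] \<in> ?T}" using v cmj_tree_snoc_mono by blast
        ultimately have "card {..j} \<le> m" using card_mono le_trans by blast
        then show "j < m" by simp
      qed
      have "w \<in> lists {..<m}" using w
      proof (induction w rule: rev_induct)
        case (snoc j w)
        then show ?case using jm cmj_tree_prefix[of w "[j]"] by auto
      qed simp
      then show "w \<in> ?S" using w T by auto
    qed
    define n where "n = max N (Suc (card ?S))"
    have fin: "finite (cmj_tree Y (cmj_tau Y n))"
      using sub[of n] trunc by (auto simp: n_def intro: finite_subset)
    have "n \<le> card (cmj_tree Y (cmj_tau Y n))"
      using fin t(2)[of n] by (intro card_cmj_tree_tau) (auto simp: le_less_trans)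
    also have "\<dots> \<le> card ?S"
      using sub[of n] trunc by (intro card_mono) (auto simp: n_def)
    finally show False by (simp add: n_def)
  next
    case False
    have fin: "finite (cmj_tree Y (ennreal t))" if "0 \<le> t" for t
    proof (rule ccontr)
      assume "infinite (cmj_tree Y (ennreal t))"
      then have "cmj_tau Y n \<le> ennreal t" for n
        unfolding cmj_tau_def by (intro Inf_lower) auto
      with False that show False by blast
    qed
    obtain v where v: "v \<noteq> u" using not_Cons_self[of undefined u] by blast
    define g where "g n = (\<Sum>j<n. y u j - y v j)" for n
    \<comment> \<open>Exceeding the values \<open>g n\<close> for all \<open>n \<le> Suc N\<close>
      forces the overtaking index beyond \<open>Suc N\<close>, so that the tree found then has at
      least \<open>N\<close> nodes; the remaining entry makes up for the different birth times of
      \<open>u\<close> and \<open>v\<close>.\<close>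
    define C where "C = Max (insert (rbirth y v - rbirth y u) (g ` {..Suc N}))"
    obtain n where n: "C < g n" using unb[of u v C] v by (auto simp: g_def)
    have nN: "Suc N < n"
    proof (rule ccontr)
      assume "\<not> Suc N < n"
      then have "g n \<le> C" unfolding C_def by (intro Max_ge) auto
      with n show False by simp
    qed
    have "rbirth y v - rbirth y u \<le> C" unfolding C_def by (intro Max_ge) auto
    with n have less: "kid y v n < kid y u n"
      by (simp add: kid_def g_def sum_subtractf)
    obtain k where k: "n = Suc k" using nN by (cases n) auto
    \<comment> \<open>At this moment \<open>v\<close> has at least \<open>Suc k\<close> children,
      while \<open>u @ [k]\<close> is still unborn and \<open>u\<close> has at most
      \<open>k\<close>.\<close>
    define T where "T = cmj_tree Y (birth Y (v @ [k]))"
    have finT: "finite T"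
      unfolding T_def birth_ennreal[OF y_nonneg] by (intro fin rbirth_nonneg)
    have vk: "v @ [k] \<in> T" by (simp add: T_def cmj_tree_def)
    have vj: "{..k} \<subseteq> {j. v @ [j] \<in> T}"
      using vk cmj_tree_snoc_mono unfolding T_def by blast
    have finj: "finite {j. w @ [j] \<in> T}" for w
    proof (rule finite_subset[OF _ finite_vimageI[OF finT]])
      show "{j. w @ [j] \<in> T} \<subseteq> (\<lambda>j. w @ [j]) -` T" by auto
    qed (auto simp: inj_def)
    have "(\<lambda>j. v @ [j]) ` {..k} \<subseteq> T" using vj by auto
    then have "card ((\<lambda>j. v @ [j]) ` {..k}) \<le> card T" by (intro card_mono finT)
    then have "Suc k \<le> card T" by (subst (asm) card_image) (auto simp: inj_on_def)
    then have "N \<le> card T" using nN k by simp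
    then have "has_max_outdeg u T"
      using u[of "card T"] cmj_tau_at_birth[of "v @ [k]"] finT by (simp add: T_def)
    moreover have vT: "v \<in> T" using vk cmj_tree_prefix unfolding T_def by blast
    ultimately have *: "outdeg v T \<le> outdeg u T" by (auto simp: has_max_outdeg_def)
    have uT: "u \<in> T" using * vT finj[of v] by (auto simp: outdeg_def split: if_splits)
    have "card {..k} \<le> card {j. v @ [j] \<in> T}" by (intro card_mono finj vj)
    also have "\<dots> \<le> card {j. u @ [j] \<in> T}"
      using * uT vT finj by (auto simp: outdeg_def)
    also have "\<dots> \<le> card {..<k}"
    proof (intro card_mono, simp, rule subsetI, rule ccontr)
      fix j assume "j \<in> {j. u @ [j] \<in> T}" "j \<notin> {..<k}"
      then have "u @ [j] \<in> T" "k \<le> j" by auto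
      then have "u @ [k] \<in> T" using cmj_tree_snoc_mono unfolding T_def by blast
      then have "rbirth y (u @ [k]) \<le> rbirth y (v @ [k])"
        unfolding T_def birth_ennreal[OF y_nonneg] by (simp add: mem_cmj_tree rbirth_nonneg)
      then show False using less k by (simp add: rbirth_snoc)
    qed
    finally show False by simp
  qed
qed

end

section \<open>Sums of independent symmetric random variables\<close>

text \<open>All quantifiers range over countable sets, so the measurability of convergence events
  follows by closure under countable operations.\<close>

lemma seq_tendsto_iff_nat:
  fixes f :: "nat \<Rightarrow> real"
  shows "f \<longlonglongrightarrow> c \<longleftrightarrow> (\<forall>m. \<exists>N. \<forall>n\<ge>N. \<bar>f n - c\<bar> < inverse (real (Suc m)))"
proof
  assume "f \<longlonglongrightarrow> c"
  then show "\<forall>m. \<exists>N. \<forall>n\<ge>N. \<bar>f n - c\<bar> < inverse (real (Suc m))"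
    unfolding LIMSEQ_iff real_norm_def by (metis inverse_positive_iff_positive of_nat_0_less_iff zero_less_Suc)
next
  assume *: "\<forall>m. \<exists>N. \<forall>n\<ge>N. \<bar>f n - c\<bar> < inverse (real (Suc m))"
  show "f \<longlonglongrightarrow> c"
    unfolding LIMSEQ_iff real_norm_def
  proof safe
    fix r :: real assume "0 < r"
    then obtain m where m: "inverse (real (Suc m)) < r" using reals_Archimedean by blast
    from * obtain N where "\<forall>n\<ge>N. \<bar>f n - c\<bar> < inverse (real (Suc m))" by blast
    with m show "\<exists>no. \<forall>n\<ge>no. \<bar>f n - c\<bar> < r" by (intro exI[of _ N]) force
  qed
qed

lemma pred_seq_tendsto [measurable (raw)]:
  fixes f :: "nat \<Rightarrow> 'a \<Rightarrow> real"
  assumes [measurable]: "\<And>n. f n \<in> borel_measurable M" "c \<in> borel_measurable M"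
  shows "Measurable.pred M (\<lambda>x. (\<lambda>n. f n x) \<longlonglongrightarrow> c x)"
  unfolding seq_tendsto_iff_nat by measurable

lemma borel_measurable_partial_sum [measurable]:
  "(\<lambda>z :: nat \<Rightarrow> real. \<Sum>i<n. z i) \<in> borel_measurable (PiM UNIV (\<lambda>_. borel))"
  by (intro borel_measurable_sum) simp

section \<open>Reflection of symmetric walks, maximal inequality and exclusion of ties\<close>

definition flip_from :: "nat \<Rightarrow> (nat \<Rightarrow> real) \<Rightarrow> nat \<Rightarrow> real" where
  "flip_from k z i = (if i < k then z i else - z i)"

lemma sum_flip_from_le: "n \<le> k \<Longrightarrow> (\<Sum>i<n. flip_from k z i) = (\<Sum>i<n. z i)"
  by (intro sum.cong) (auto simp: flip_from_def)

lemma sum_flip_from_ge: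
  assumes "k \<le> n" shows "(\<Sum>i<n. flip_from k z i) = 2 * (\<Sum>i<k. z i) - (\<Sum>i<n. z i)"
proof -
  have *: "(\<Sum>i<n. g i) = (\<Sum>i<k. g i) + (\<Sum>i\<in>{k..<n}. g i)" for g :: "nat \<Rightarrow> real"
    using assms by (metis atLeast0LessThan sum.atLeastLessThan_concat zero_le)
  have "(\<Sum>i\<in>{k..<n}. flip_from k z i) = - (\<Sum>i\<in>{k..<n}. z i)"
    unfolding sum_negf[symmetric] by (intro sum.cong) (auto simp: flip_from_def)
  then show ?thesis
    using sum_flip_from_le[of k k z] *[of z] *[of "flip_from k z"] by simp
qed

context prob_space
begin

text \<open>Both sequences have independent coordinates, so their laws are product measures, and the
  factors agree by symmetry.\<close>

lemma distr_flip_from: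
  fixes D :: "nat \<Rightarrow> 'a \<Rightarrow> real"
  assumes indep: "indep_vars (\<lambda>_. borel) D UNIV"
    and sym: "\<And>i. k \<le> i \<Longrightarrow> distr M borel (D i) = distr M borel (\<lambda>\<omega>. - D i \<omega>)"
  shows "distr M (PiM UNIV (\<lambda>_. borel)) (\<lambda>\<omega>. flip_from k (\<lambda>i. D i \<omega>)) =
         distr M (PiM UNIV (\<lambda>_. borel)) (\<lambda>\<omega> i. D i \<omega>)"
proof -
  have [measurable]: "D i \<in> borel_measurable M" for i
    using indep by (auto simp: indep_vars_def)
  have "indep_vars (\<lambda>_. borel) (\<lambda>i \<omega>. (if i < k then id else uminus) (D i \<omega>)) UNIV"
    by (rule indep_vars_compose2[OF indep]) auto
  then have "indep_vars (\<lambda>_. borel) (\<lambda>i \<omega>. flip_from k (\<lambda>i. D i \<omega>) i) UNIV"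
    by (rule indep_vars_cong[THEN iffD1, rotated -1]) (auto simp: flip_from_def fun_eq_iff)
  then have "distr M (PiM UNIV (\<lambda>_. borel)) (\<lambda>\<omega>. flip_from k (\<lambda>i. D i \<omega>)) =
      PiM UNIV (\<lambda>i. distr M borel (\<lambda>\<omega>. flip_from k (\<lambda>i. D i \<omega>) i))"
    by (subst (asm) indep_vars_iff_distr_eq_PiM) (auto simp: flip_from_def[abs_def] restrict_def)
  also have "\<dots> = PiM UNIV (\<lambda>i. distr M borel (D i))"
  proof (intro PiM_cong refl)
    fix i show "distr M borel (\<lambda>\<omega>. flip_from k (\<lambda>i. D i \<omega>) i) = distr M borel (D i)"
      using sym[of i] by (cases "i < k") (auto simp: flip_from_def)
  qed
  also have "\<dots> = distr M (PiM UNIV (\<lambda>_. borel)) (\<lambda>\<omega> i. D i \<omega>)"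
    using indep by (subst (asm) indep_vars_iff_distr_eq_PiM) (auto simp: restrict_def)
  finally show ?thesis .
qed

text \<open>A deterministic \<open>k\<close> is enough for reflection at a random first passage: one
  decomposes by its value, and the event that it equals \<open>k\<close> depends only on the first
  \<open>k\<close> increments, which the flip leaves alone.\<close>

lemma prob_flip_from:
  fixes D :: "nat \<Rightarrow> 'a \<Rightarrow> real"
  assumes indep: "indep_vars (\<lambda>_. borel) D UNIV"
    and sym: "\<And>i. k \<le> i \<Longrightarrow> distr M borel (D i) = distr M borel (\<lambda>\<omega>. - D i \<omega>)"
    and P: "Measurable.pred (PiM UNIV (\<lambda>_. borel)) P"
  shows "\<P>(\<omega> in M. P (flip_from k (\<lambda>i. D i \<omega>))) = \<P>(\<omega> in M. P (\<lambda>i. D i \<omega>))"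
proof -
  have [measurable]: "D i \<in> borel_measurable M" for i
    using indep by (auto simp: indep_vars_def)
  have m1: "(\<lambda>\<omega> i. D i \<omega>) \<in> measurable M (PiM UNIV (\<lambda>_. borel))"
    by (intro measurable_PiM_single') auto
  have "(\<lambda>\<omega> i. flip_from k (\<lambda>i. D i \<omega>) i) \<in> measurable M (PiM UNIV (\<lambda>_. borel))"
    by (intro measurable_PiM_single') (auto simp: flip_from_def)
  then have m2: "(\<lambda>\<omega>. flip_from k (\<lambda>i. D i \<omega>)) \<in> measurable M (PiM UNIV (\<lambda>_. borel))"
    by simp
  have A: "{z. P z} \<in> sets (PiM UNIV (\<lambda>_. borel))"
    using P by (simp add: pred_def space_PiM)
  have "measure (distr M (PiM UNIV (\<lambda>_. borel)) (\<lambda>\<omega>. flip_from k (\<lambda>i. D i \<omega>))) {z. P z} =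
        measure (distr M (PiM UNIV (\<lambda>_. borel)) (\<lambda>\<omega> i. D i \<omega>)) {z. P z}"
    by (simp only: distr_flip_from[OF indep sym])
  then show ?thesis
    by (subst (asm) (1 2) measure_distr) (auto simp: m1 m2 A vimage_def Int_def conj_commute)
qed

text \<open>Given that the first positive value in the window occurs at time \<open>k\<close>,
  symmetry gives the walk at least probability 1/2 to end no lower than at \<open>k\<close>, and
  then its final value is positive. The increments before \<open>m\<close> belong to the start and
  may have any law.\<close>

lemma levy_inequality:
  fixes D :: "nat \<Rightarrow> 'a \<Rightarrow> real"
  assumes indep: "indep_vars (\<lambda>_. borel) D UNIV"
    and sym: "\<And>i. m \<le> i \<Longrightarrow> distr M borel (D i) = distr M borel (\<lambda>\<omega>. - D i \<omega>)"
  shows "\<P>(\<omega> in M. \<exists>n\<in>{m..N}. 0 < c + (\<Sum>i<n. D i \<omega>)) \<le> 2 * \<P>(\<omega> in M. 0 < c + (\<Sum>i<N. D i \<omega>))"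
proof -
  have [measurable]: "D i \<in> borel_measurable M" for i
    using indep by (auto simp: indep_vars_def)
  define T where "T k z \<longleftrightarrow> 0 < c + (\<Sum>i<k. z i) \<and> (\<forall>j\<in>{m..<k}. \<not> 0 < c + (\<Sum>i<j. z i))"
    for k and z :: "nat \<Rightarrow> real"
  have [measurable]: "Measurable.pred (PiM UNIV (\<lambda>_. borel)) (T k)" for k
    unfolding T_def by measurable
  have [measurable]: "Measurable.pred M (\<lambda>\<omega>. T k (\<lambda>i. D i \<omega>))" for k
    unfolding T_def by measurable
  define E where "E k = {\<omega>\<in>space M. T k (\<lambda>i. D i \<omega>)}" for k
  define E' where "E' k = {\<omega>\<in>space M. T k (\<lambda>i. D i \<omega>) \<and> 0 < c + (\<Sum>i<N. D i \<omega>)}" for k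
  have E [measurable]: "E k \<in> sets M" "E' k \<in> sets M" for k
    unfolding E_def E'_def by measurable
  have disj: "k = l" if "T k z" "T l z" "k \<in> {m..N}" "l \<in> {m..N}" for k l z
    using that unfolding T_def by (metis atLeastAtMost_iff atLeastLessThan_iff not_less_iff_gr_or_eq)
  have le: "prob (E k) \<le> 2 * prob (E' k)" if k: "k \<in> {m..N}" for k
  proof -
    \<comment> \<open>The flip at \<open>k\<close> replaces the final sum by twice the sum at
      \<open>k\<close> minus the final sum, which exchanges \<open>?A\<close> and \<open>?B\<close>.
      Together they cover \<open>E k\<close>, so \<open>?A\<close> carries at least half of its
      probability.\<close>
    let ?A = "\<lambda>z. T k z \<and> (\<Sum>i<k. z i) \<le> (\<Sum>i<N. z i)"
    let ?B = "\<lambda>z. T k z \<and> (\<Sum>i<N. z i) \<le> (\<Sum>i<k. z i)"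
    have [measurable]: "Measurable.pred (PiM UNIV (\<lambda>_. borel)) (\<lambda>z. (\<Sum>i<N. z i) \<le> (\<Sum>i<k. z i :: real))"
      unfolding pred_def by (rule borel_measurable_le) measurable
    have mB: "Measurable.pred (PiM UNIV (\<lambda>_. borel)) ?B" by measurable
    have "?B (flip_from k z) = ?A z" for z
    proof -
      have "T k (flip_from k z) = T k z" by (auto simp: T_def sum_flip_from_le)
      then show ?thesis using k by (auto simp: sum_flip_from_le sum_flip_from_ge)
    qed
    then have AB: "\<P>(\<omega> in M. ?A (\<lambda>i. D i \<omega>)) = \<P>(\<omega> in M. ?B (\<lambda>i. D i \<omega>))"
      using prob_flip_from[OF indep sym, of k ?B, OF _ mB] k by simp
    have "prob (E k) \<le> prob ({\<omega>\<in>space M. ?A (\<lambda>i. D i \<omega>)} \<union> {\<omega>\<in>space M. ?B (\<lambda>i. D i \<omega>)})"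
      by (intro finite_measure_mono) (auto simp: E_def)
    also have "\<dots> \<le> \<P>(\<omega> in M. ?A (\<lambda>i. D i \<omega>)) + \<P>(\<omega> in M. ?B (\<lambda>i. D i \<omega>))"
      by (intro measure_Un_le) auto
    also have "\<dots> = 2 * \<P>(\<omega> in M. ?A (\<lambda>i. D i \<omega>))" by (simp add: AB)
    also have "\<P>(\<omega> in M. ?A (\<lambda>i. D i \<omega>)) \<le> prob (E' k)"
      by (intro finite_measure_mono) (auto simp: E'_def T_def)
    finally show ?thesis by simp
  qed
  have ex: "\<exists>k\<in>{m..N}. T k z" if "n \<in> {m..N}" "0 < c + (\<Sum>i<n. z i)" for n z
  proof -
    define k where "k = (LEAST k. m \<le> k \<and> 0 < c + (\<Sum>i<k. z i))"
    have "m \<le> k \<and> 0 < c + (\<Sum>i<k. z i)"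
      unfolding k_def by (rule LeastI[of _ n]) (use that in auto)
    moreover have "k \<le> n" unfolding k_def by (rule Least_le) (use that in auto)
    moreover have "\<not> 0 < c + (\<Sum>i<j. z i)" if "j \<in> {m..<k}" for j
      using not_less_Least[of j "\<lambda>k. m \<le> k \<and> 0 < c + (\<Sum>i<k. z i)"] that by (auto simp: k_def)
    ultimately show ?thesis using that by (auto simp: T_def)
  qed
  have "\<P>(\<omega> in M. \<exists>n\<in>{m..N}. 0 < c + (\<Sum>i<n. D i \<omega>)) \<le> prob (\<Union>k\<in>{m..N}. E k)"
    using ex by (intro finite_measure_mono sets.finite_UN) (auto simp: E_def)
  also have "\<dots> \<le> (\<Sum>k\<in>{m..N}. prob (E k))"
    by (intro finite_measure_subadditive_finite) auto
  also have "\<dots> \<le> (\<Sum>k\<in>{m..N}. 2 * prob (E' k))"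
    by (intro sum_mono le)
  also have "\<dots> = 2 * prob (\<Union>k\<in>{m..N}. E' k)"
    unfolding sum_distrib_left[symmetric]
    by (subst finite_measure_finite_Union)
       (auto simp: disjoint_family_on_def E'_def dest: disj)
  also have "prob (\<Union>k\<in>{m..N}. E' k) \<le> \<P>(\<omega> in M. 0 < c + (\<Sum>i<N. D i \<omega>))"
    by (intro finite_measure_mono) (auto simp: E'_def)
  finally show ?thesis by simp
qed

text \<open>Reflecting the partial sums \<open>W\<close> at the first time \<open>k \<ge> n\<close> with \<open>W\<^sub>k \<noteq> 0\<close> turns \<open>W \<longrightarrow> 0\<close> into
  \<open>W \<longrightarrow> 2 W\<^sub>k\<close> without changing probabilities, and the latter cannot happen for infinitely many \<open>k\<close>.\<close>

lemma AE_tendsto_0_imp_eventually_0: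
  fixes D :: "nat \<Rightarrow> 'a \<Rightarrow> real"
  assumes indep: "indep_vars (\<lambda>_. borel) D UNIV"
    and sym: "\<And>i. 1 \<le> i \<Longrightarrow> distr M borel (D i) = distr M borel (\<lambda>\<omega>. - D i \<omega>)"
  shows "AE \<omega> in M. (\<lambda>n. \<Sum>i<n. D i \<omega>) \<longlonglongrightarrow> 0 \<longrightarrow> (\<forall>\<^sub>F n in sequentially. (\<Sum>i<n. D i \<omega>) = 0)"
proof -
  have [measurable]: "D i \<in> borel_measurable M" for i
    using indep by (auto simp: indep_vars_def)
  define T where "T n k z \<longleftrightarrow> (\<Sum>i<k. z i) \<noteq> 0 \<and> (\<forall>j\<in>{n..<k}. (\<Sum>i<j. z i) = 0)"
    for n k and z :: "nat \<Rightarrow> real"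
  have [measurable]: "Measurable.pred (PiM UNIV (\<lambda>_. borel)) (T n k)" for n k
    unfolding T_def by measurable
  have [measurable]: "Measurable.pred M (\<lambda>\<omega>. T n k (\<lambda>i. D i \<omega>))" for n k
    unfolding T_def by measurable
  have disj: "k = l" if "T n k z" "T n l z" "n \<le> k" "n \<le> l" for k l z n
    using that unfolding T_def by (metis atLeastLessThan_iff not_less_iff_gr_or_eq)
  let ?W = "\<lambda>n \<omega>. \<Sum>i<n. D i \<omega>"
  define E where "E n k = {\<omega>\<in>space M. T n k (\<lambda>i. D i \<omega>) \<and> (\<lambda>m. ?W m \<omega>) \<longlonglongrightarrow> 0}" for n k
  define E' where "E' n k = {\<omega>\<in>space M. T n k (\<lambda>i. D i \<omega>) \<and> (\<lambda>m. ?W m \<omega>) \<longlonglongrightarrow> 2 * ?W k \<omega>}" for n k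
  define H where "H n = {\<omega>\<in>space M. \<exists>k\<ge>n. ?W k \<omega> \<noteq> 0 \<and> (\<lambda>m. ?W m \<omega>) \<longlonglongrightarrow> 2 * ?W k \<omega>}" for n
  define B where "B = {\<omega>\<in>space M. (\<lambda>m. ?W m \<omega>) \<longlonglongrightarrow> 0 \<and> (\<forall>n. \<exists>k\<ge>n. ?W k \<omega> \<noteq> 0)}"
  have [measurable]: "E n k \<in> sets M" "E' n k \<in> sets M" "H n \<in> sets M" "B \<in> sets M" for n k
    unfolding E_def E'_def H_def B_def by measurable
  \<comment> \<open>\<open>1 \<le> n\<close> keeps the flip away from the increment
    \<open>D 0\<close>, which need not be symmetric.\<close>
  have eq: "prob (E n k) = prob (E' n k)" if "1 \<le> n" "n \<le> k" for n k
  proof -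
    let ?P = "\<lambda>z. T n k z \<and> (\<lambda>m. \<Sum>i<m. z i) \<longlonglongrightarrow> (0::real)"
    have mP: "Measurable.pred (PiM UNIV (\<lambda>_. borel)) ?P" by measurable
    have "?P (flip_from k z) \<longleftrightarrow> T n k z \<and> (\<lambda>m. \<Sum>i<m. z i) \<longlonglongrightarrow> 2 * (\<Sum>i<k. z i)" for z
    proof -
      have T: "T n k (flip_from k z) = T n k z" by (auto simp: T_def sum_flip_from_le)
      have "(\<lambda>m. \<Sum>i<m. flip_from k z i) \<longlonglongrightarrow> 0 \<longleftrightarrow> (\<lambda>m. 2 * (\<Sum>i<k. z i) - (\<Sum>i<m. z i)) \<longlonglongrightarrow> 0"
        using eventually_ge_at_top[of k]
        by (intro tendsto_cong, eventually_elim) (simp add: sum_flip_from_ge)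
      also have "\<dots> \<longleftrightarrow> (\<lambda>m. \<Sum>i<m. z i) \<longlonglongrightarrow> 2 * (\<Sum>i<k. z i)"
        using tendsto_diff[OF tendsto_const[of "2 * (\<Sum>i<k. z i)"], of "\<lambda>m. 2 * (\<Sum>i<k. z i) - (\<Sum>i<m. z i)" 0]
          tendsto_diff[OF tendsto_const[of "2 * (\<Sum>i<k. z i)"], of "\<lambda>m. \<Sum>i<m. z i" "2 * (\<Sum>i<k. z i)"]
        by auto
      finally show ?thesis using T by simp
    qed
    then show ?thesis
      using prob_flip_from[OF indep sym, of k ?P, OF _ mP] that by (simp add: E_def E'_def)
  qed
  have ex: "\<exists>k\<ge>n. T n k z" if "l \<ge> n" "(\<Sum>i<l. z i) \<noteq> 0" for n l z
  proof -
    define k where "k = (LEAST k. n \<le> k \<and> (\<Sum>i<k. z i) \<noteq> 0)"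
    have "n \<le> k \<and> (\<Sum>i<k. z i) \<noteq> 0"
      unfolding k_def by (rule LeastI[of _ l]) (use that in auto)
    moreover have "(\<Sum>i<j. z i) = 0" if "j \<in> {n..<k}" for j
      using not_less_Least[of j "\<lambda>k. n \<le> k \<and> (\<Sum>i<k. z i) \<noteq> 0"] that by (auto simp: k_def)
    ultimately show ?thesis by (auto simp: T_def)
  qed
  have BH: "prob B \<le> prob (H n)" if n: "1 \<le> n" for n
  proof -
    have dE: "k = l" if "\<omega> \<in> E n (n + k)" "\<omega> \<in> E n (n + l)" for \<omega> k l
      using disj[of n "n + k" "\<lambda>i. D i \<omega>" "n + l"] that by (simp add: E_def)
    have dE': "k = l" if "\<omega> \<in> E' n (n + k)" "\<omega> \<in> E' n (n + l)" for \<omega> k l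
      using disj[of n "n + k" "\<lambda>i. D i \<omega>" "n + l"] that by (simp add: E'_def)
    have "prob B \<le> prob (\<Union>k. E n (n + k))"
    proof (intro finite_measure_mono subsetI)
      fix \<omega> assume "\<omega> \<in> B"
      then obtain l where "n \<le> l" "?W l \<omega> \<noteq> 0" unfolding B_def by blast
      then obtain k where "n \<le> k" "T n k (\<lambda>i. D i \<omega>)" using ex by blast
      then have "\<omega> \<in> E n (n + (k - n))"
        using \<open>\<omega> \<in> B\<close> by (simp add: B_def E_def)
      then show "\<omega> \<in> (\<Union>k. E n (n + k))" by blast
    qed auto
    also have "\<dots> = (\<Sum>k. prob (E n (n + k)))"
      by (intro finite_measure_UNION[THEN sums_unique])
         (auto simp: disjoint_family_on_def dest: dE)
    also have "\<dots> = (\<Sum>k. prob (E' n (n + k)))"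
      using n by (simp add: eq)
    also have "\<dots> = prob (\<Union>k. E' n (n + k))"
      by (intro finite_measure_UNION[THEN sums_unique, symmetric])
         (auto simp: disjoint_family_on_def dest: dE')
    also have "\<dots> \<le> prob (H n)"
    proof (intro finite_measure_mono subsetI)
      fix \<omega> assume "\<omega> \<in> (\<Union>k. E' n (n + k))"
      then obtain k where "\<omega> \<in> E' n (n + k)" by blast
      then show "\<omega> \<in> H n" unfolding E'_def H_def T_def by (auto intro!: exI[of _ "n + k"])
    qed auto
    finally show ?thesis .
  qed
  have "(\<lambda>n. prob (H n)) \<longlonglongrightarrow> prob (\<Inter>n. H n)"
    by (intro finite_Lim_measure_decseq) (auto simp: decseq_def H_def intro: order_trans)
  \<comment> \<open>Here the sums would converge to some \<open>w \<noteq> 0\<close>, because the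
    limit is twice a nonzero value, and yet equal \<open>w / 2\<close> infinitely often.\<close>
  moreover have "(\<Inter>n. H n) = {}"
  proof (rule ccontr)
    assume "(\<Inter>n. H n) \<noteq> {}"
    then obtain \<omega> where \<omega>: "\<And>n. \<omega> \<in> H n" by blast
    from \<omega>[of 0] obtain w where w: "(\<lambda>m. ?W m \<omega>) \<longlonglongrightarrow> w" by (auto simp: H_def)
    have "\<exists>k\<ge>n. ?W k \<omega> \<noteq> 0 \<and> 2 * ?W k \<omega> = w" for n
      using \<omega>[of n] LIMSEQ_unique[OF w] by (auto simp: H_def)
    then have fr: "\<exists>k\<ge>n. ?W k \<omega> = w / 2 \<and> w \<noteq> 0" for n by fastforce
    then have "w \<noteq> 0" by blast
    then have "\<forall>\<^sub>F k in sequentially. \<bar>?W k \<omega> - w\<bar> < \<bar>w\<bar> / 2"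
      using tendstoD[OF w, of "\<bar>w\<bar> / 2"] by (simp add: dist_real_def)
    then obtain n where "\<And>k. k \<ge> n \<Longrightarrow> \<bar>?W k \<omega> - w\<bar> < \<bar>w\<bar> / 2"
      by (auto simp: eventually_sequentially)
    moreover obtain k where "k \<ge> n" "?W k \<omega> = w / 2" using fr by blast
    ultimately have "\<bar>w / 2 - w\<bar> < \<bar>w\<bar> / 2" by metis
    then show False by auto
  qed
  ultimately have "(\<lambda>n. prob (H n)) \<longlonglongrightarrow> 0" by simp
  then have "prob B \<le> 0"
    by (rule LIMSEQ_le_const) (use BH in blast)
  then have "AE \<omega> in M. \<omega> \<notin> B"
    by (intro AE_not_in) (auto simp: null_sets_def emeasure_eq_measure measure_le_0_iff)
  then show ?thesis
    using AE_space
  proof eventually_elim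
    case (elim \<omega>)
    then show ?case by (auto simp: B_def eventually_sequentially)
  qed
qed

section \<open>Almost sure convergence from summable second moments\<close>

lemma indep_vars_inj_reindex:
  assumes "indep_vars (\<lambda>_. N) X UNIV" "inj f"
  shows "indep_vars (\<lambda>_. N) (\<lambda>j. X (f j)) UNIV"
proof -
  have "indep_vars (\<lambda>j. PiM {f j} (\<lambda>_. N)) (\<lambda>j \<omega>. restrict (\<lambda>i. X i \<omega>) {f j}) UNIV"
    using assms by (intro indep_vars_restrict) (auto simp: disjoint_family_on_def inj_def)
  then have "indep_vars (\<lambda>_. N) (\<lambda>j \<omega>. (\<lambda>z. z (f j)) (restrict (\<lambda>i. X i \<omega>) {f j})) UNIV"
    by (rule indep_vars_compose2) simp
  then show ?thesis by simp
qed

text \<open>Replacing \<open>D\<close> by its negative keeps the law and changes the sign of the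
  integral. If \<open>h (D \<omega>)\<close> is not integrable, the integral has its default value 0
  and the claim agrees with it.\<close>

lemma expectation_symmetric_odd:
  fixes D :: "'a \<Rightarrow> real" and h :: "real \<Rightarrow> real"
  assumes [measurable]: "D \<in> borel_measurable M" "h \<in> borel_measurable borel"
    and sym: "distr M borel D = distr M borel (\<lambda>\<omega>. - D \<omega>)"
    and odd: "\<And>x. h (- x) = - h x"
  shows "expectation (\<lambda>\<omega>. h (D \<omega>)) = 0"
proof -
  have "expectation (\<lambda>\<omega>. h (D \<omega>)) = integral\<^sup>L (distr M borel D) h"
    by (simp add: integral_distr)
  also have "\<dots> = integral\<^sup>L (distr M borel (\<lambda>\<omega>. - D \<omega>)) h"
    by (simp only: sym)
  also have "\<dots> = expectation (\<lambda>\<omega>. h (- D \<omega>))"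
    by (simp add: integral_distr)
  also have "\<dots> = - expectation (\<lambda>\<omega>. h (D \<omega>))" by (simp add: odd)
  finally show ?thesis by simp
qed

lemma distr_symmetric_odd:
  fixes D :: "'a \<Rightarrow> real" and h :: "real \<Rightarrow> real"
  assumes [measurable]: "D \<in> borel_measurable M" "h \<in> borel_measurable borel"
    and sym: "distr M borel D = distr M borel (\<lambda>\<omega>. - D \<omega>)"
    and odd: "\<And>x. h (- x) = - h x"
  shows "distr M borel (\<lambda>\<omega>. h (D \<omega>)) = distr M borel (\<lambda>\<omega>. - h (D \<omega>))"
proof -
  have "distr M borel (\<lambda>\<omega>. h (D \<omega>)) = distr (distr M borel D) borel h"
    by (simp add: distr_distr comp_def)
  also have "\<dots> = distr (distr M borel (\<lambda>\<omega>. - D \<omega>)) borel h" by (simp only: sym)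
  also have "\<dots> = distr M borel (\<lambda>\<omega>. - h (D \<omega>))"
    by (simp add: distr_distr comp_def odd)
  finally show ?thesis .
qed

text \<open>The mixed terms vanish: by independence they are products of means, and symmetric
  variables have mean 0.\<close>

lemma second_moment_sum_symmetric:
  fixes D :: "nat \<Rightarrow> 'a \<Rightarrow> real"
  assumes indep: "indep_vars (\<lambda>_. borel) D UNIV"
    and sym: "\<And>i. distr M borel (D i) = distr M borel (\<lambda>\<omega>. - D i \<omega>)"
    and L2: "\<And>i. integrable M (\<lambda>\<omega>. (D i \<omega>)\<^sup>2)"
    and I: "finite I"
  shows "integrable M (\<lambda>\<omega>. (\<Sum>i\<in>I. D i \<omega>)\<^sup>2) \<and>
         expectation (\<lambda>\<omega>. (\<Sum>i\<in>I. D i \<omega>)\<^sup>2) = (\<Sum>i\<in>I. expectation (\<lambda>\<omega>. (D i \<omega>)\<^sup>2))"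
  using I
proof (induction I)
  case (insert a I)
  have [measurable]: "D i \<in> borel_measurable M" for i
    using indep by (auto simp: indep_vars_def)
  have int: "integrable M (D i)" for i
    by (rule square_integrable_imp_integrable[OF _ L2]) simp
  have z: "expectation (D i) = 0" for i
    by (rule expectation_symmetric_odd[of "D i" "\<lambda>x. x", OF _ _ sym]) auto
  have ind: "indep_var borel (D a) borel (\<lambda>\<omega>. \<Sum>i\<in>I. D i \<omega>)"
    using insert by (intro indep_vars_sum indep_vars_subset[OF indep]) auto
  have ints: "integrable M (\<lambda>\<omega>. \<Sum>i\<in>I. D i \<omega>)" using int by auto
  have prod: "integrable M (\<lambda>\<omega>. D a \<omega> * (\<Sum>i\<in>I. D i \<omega>))"
    "expectation (\<lambda>\<omega>. D a \<omega> * (\<Sum>i\<in>I. D i \<omega>)) = 0"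
    using indep_var_integrable[OF ind int ints] indep_var_lebesgue_integral[OF ind int ints] z by auto
  have eq: "(\<Sum>i\<in>insert a I. D i \<omega>)\<^sup>2 = (D a \<omega>)\<^sup>2 + 2 * (D a \<omega> * (\<Sum>i\<in>I. D i \<omega>)) + (\<Sum>i\<in>I. D i \<omega>)\<^sup>2" for \<omega>
    using insert by (simp add: power2_sum algebra_simps)
  show ?case
    unfolding eq using insert L2 prod by simp
qed simp

text \<open>Kolmogorov's one-series theorem in the symmetric case. Levy's inequality and Markov's
  inequality for squares bound the fluctuation after index \<open>n\<close> by a tail of the
  variance series.\<close>

lemma AE_summable_symmetric:
  fixes D :: "nat \<Rightarrow> 'a \<Rightarrow> real"
  assumes indep: "indep_vars (\<lambda>_. borel) D UNIV"
    and sym: "\<And>i. distr M borel (D i) = distr M borel (\<lambda>\<omega>. - D i \<omega>)"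
    and L2: "\<And>i. integrable M (\<lambda>\<omega>. (D i \<omega>)\<^sup>2)"
    and summ: "summable (\<lambda>i. expectation (\<lambda>\<omega>. (D i \<omega>)\<^sup>2))"
  shows "AE \<omega> in M. summable (\<lambda>i. D i \<omega>)"
proof -
  have [measurable]: "D i \<in> borel_measurable M" for i
    using indep by (auto simp: indep_vars_def)
  define v where "v i = expectation (\<lambda>\<omega>. (D i \<omega>)\<^sup>2)" for i
  have v0: "0 \<le> v i" for i by (simp add: v_def)
  let ?S = "\<lambda>n k \<omega>. \<Sum>i<k. D (n + i) \<omega>"
  \<comment> \<open>The sign \<open>s\<close> gives the upper and the lower deviation at once;
    adding the two turns the factor 2 of the maximal inequality into the 4 below.\<close>
  have max1: "\<P>(\<omega> in M. \<exists>k\<in>{0..N}. 0 < - e + (\<Sum>i<k. s * D (n + i) \<omega>)) \<le> 2 * (\<Sum>i. v (i + n)) / e\<^sup>2"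
    if e: "0 < e" and s: "s = 1 \<or> s = -1" for e s n N
  proof -
    define X where "X i \<omega> = s * D (n + i) \<omega>" for i \<omega>
    have indX: "indep_vars (\<lambda>_. borel) X UNIV"
      using indep_vars_compose2[OF indep_vars_inj_reindex[OF indep, of "\<lambda>i. n + i"],
        of "\<lambda>_ x. s * x" "\<lambda>_. borel"] by (simp add: X_def[abs_def] inj_def)
    have symX: "distr M borel (X i) = distr M borel (\<lambda>\<omega>. - X i \<omega>)" for i
      unfolding X_def using sym by (intro distr_symmetric_odd[of "D (n + i)" "\<lambda>x. s * x"]) auto
    have sq: "(X i \<omega>)\<^sup>2 = (D (n + i) \<omega>)\<^sup>2" for i \<omega> using s by (auto simp: X_def)
    have mom: "integrable M (\<lambda>\<omega>. (\<Sum>i\<in>{..<N}. X i \<omega>)\<^sup>2)"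
      "expectation (\<lambda>\<omega>. (\<Sum>i\<in>{..<N}. X i \<omega>)\<^sup>2) = (\<Sum>i<N. v (n + i))"
      using second_moment_sum_symmetric[OF indX symX, of "{..<N}"] L2 by (auto simp: sq v_def)
    have [measurable]: "X i \<in> borel_measurable M" for i by (simp add: X_def[abs_def])
    have "\<P>(\<omega> in M. 0 < - e + (\<Sum>i<N. X i \<omega>)) \<le> \<P>(\<omega> in M. e\<^sup>2 \<le> (\<Sum>i<N. X i \<omega>)\<^sup>2)"
      using e by (intro finite_measure_mono) (auto intro!: power_mono)
    also have "\<dots> \<le> expectation (\<lambda>\<omega>. (\<Sum>i\<in>{..<N}. X i \<omega>)\<^sup>2) / e\<^sup>2"
      using e mom by (intro integral_Markov_inequality_measure[where A = "{}"]) auto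
    also have "\<dots> \<le> (\<Sum>i. v (i + n)) / e\<^sup>2"
      unfolding mom using summ v0
      by (intro divide_right_mono) (auto simp: add.commute v_def intro!: sum_le_suminf summable_ignore_initial_segment)
    finally show ?thesis
      using levy_inequality[OF indX symX, of 0 N "- e"] by (simp add: X_def)
  qed
  have max2: "\<P>(\<omega> in M. \<exists>k\<in>{0..N}. e < \<bar>?S n k \<omega>\<bar>) \<le> 4 * (\<Sum>i. v (i + n)) / e\<^sup>2" if e: "0 < e" for e n N
  proof -
    have "\<P>(\<omega> in M. \<exists>k\<in>{0..N}. e < \<bar>?S n k \<omega>\<bar>) \<le>
      prob ({\<omega>\<in>space M. \<exists>k\<in>{0..N}. 0 < - e + (\<Sum>i<k. 1 * D (n + i) \<omega>)} \<union>
            {\<omega>\<in>space M. \<exists>k\<in>{0..N}. 0 < - e + (\<Sum>i<k. (-1) * D (n + i) \<omega>)})"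
      by (intro finite_measure_mono) (force simp: sum_negf)+
    also have "\<dots> \<le> \<P>(\<omega> in M. \<exists>k\<in>{0..N}. 0 < - e + (\<Sum>i<k. 1 * D (n + i) \<omega>)) +
        \<P>(\<omega> in M. \<exists>k\<in>{0..N}. 0 < - e + (\<Sum>i<k. (-1) * D (n + i) \<omega>))"
      by (intro measure_Un_le) measurable
    finally show ?thesis using max1[OF e, of 1 N n] max1[OF e, of "-1" N n] by simp
  qed
  have max3: "\<P>(\<omega> in M. \<exists>k. e < \<bar>?S n k \<omega>\<bar>) \<le> 4 * (\<Sum>i. v (i + n)) / e\<^sup>2" if e: "0 < e" for e n
  proof -
    let ?A = "\<lambda>N. {\<omega>\<in>space M. \<exists>k\<in>{0..N}. e < \<bar>?S n k \<omega>\<bar>}"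
    have "(\<lambda>N. prob (?A N)) \<longlonglongrightarrow> prob (\<Union>N. ?A N)"
      by (intro finite_Lim_measure_incseq) (auto simp: incseq_def intro: order_trans)
    moreover have "(\<Union>N. ?A N) = {\<omega>\<in>space M. \<exists>k. e < \<bar>?S n k \<omega>\<bar>}"
      using atLeastAtMost_iff le0 le_refl by blast
    ultimately show ?thesis
      using max2[OF e, of _ n] by (intro LIMSEQ_le_const2) auto
  qed
  have "AE \<omega> in M. \<exists>n. \<forall>k. \<bar>?S n k \<omega>\<bar> \<le> e" if e: "0 < e" for e
  proof -
    let ?B = "{\<omega>\<in>space M. \<forall>n. \<exists>k. e < \<bar>?S n k \<omega>\<bar>}"
    have "(\<lambda>n. 4 * (\<Sum>i. v (i + n)) / e\<^sup>2) \<longlonglongrightarrow> 4 * 0 / e\<^sup>2"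
      using e summ by (intro tendsto_intros suminf_exist_split2) (auto simp: v_def)
    moreover have "prob ?B \<le> 4 * (\<Sum>i. v (i + n)) / e\<^sup>2" for n
      by (rule order_trans[OF finite_measure_mono max3[OF e, of n]]) auto
    ultimately have "prob ?B \<le> 0"
      by (intro LIMSEQ_le_const) auto
    then have "AE \<omega> in M. \<omega> \<notin> ?B"
      by (intro AE_not_in) (auto simp: null_sets_def emeasure_eq_measure measure_le_0_iff)
    then show ?thesis
      using AE_space by eventually_elim (auto simp: not_less)
  qed
  then have "AE \<omega> in M. \<forall>m::nat. \<exists>n. \<forall>k. \<bar>?S n k \<omega>\<bar> \<le> inverse (real (Suc m))"
    by (subst AE_all_countable) auto
  then show ?thesis
  proof eventually_elim
    case (elim \<omega>)
    show ?case
      unfolding summable_Cauchy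
    proof safe
      fix e :: real assume "0 < e"
      then obtain m where m: "inverse (real (Suc m)) < e / 2"
        using reals_Archimedean[of "e / 2"] by auto
      from elim obtain n where n: "\<And>k. \<bar>?S n k \<omega>\<bar> \<le> inverse (real (Suc m))" by blast
      have "norm (\<Sum>i\<in>{a..<b}. D i \<omega>) < e" if "n \<le> a" for a b
      proof (cases "a \<le> b")
        case True
        have *: "?S n (c - n) \<omega> = (\<Sum>i\<in>{n..<c}. D i \<omega>)" if "n \<le> c" for c
          using that sum.shift_bounds_nat_ivl[of "\<lambda>i. D i \<omega>" 0 n "c - n"]
          by (simp add: atLeast0LessThan add.commute)
        \<comment> \<open>A block is the difference of two sums started at \<open>n\<close>; this is
          why \<open>m\<close> was chosen for \<open>e / 2\<close>.\<close>
        have "(\<Sum>i\<in>{a..<b}. D i \<omega>) = ?S n (b - n) \<omega> - ?S n (a - n) \<omega>"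
          using True that sum.atLeastLessThan_concat[of n a b "\<lambda>i. D i \<omega>"] by (simp add: *)
        then show ?thesis
          using n[of "b - n"] n[of "a - n"] m unfolding real_norm_def by linarith
      qed (use \<open>0 < e\<close> in auto)
      then show "\<exists>N. \<forall>m\<ge>N. \<forall>n. norm (\<Sum>i\<in>{m..<n}. D i \<omega>) < e" by blast
    qed
  qed
qed

section \<open>Boundedness of symmetric walks: zero-one law and characteristic functions\<close>

lemma bounded_above_0_1:
  fixes D :: "nat \<Rightarrow> 'a \<Rightarrow> real"
  assumes indep: "indep_vars (\<lambda>_. borel) D UNIV"
  defines "B \<equiv> {\<omega>\<in>space M. \<exists>C::nat. \<forall>n. (\<Sum>i<n. D i \<omega>) \<le> real C}"
  shows "prob B = 0 \<or> prob B = 1"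
proof -
  have D [measurable]: "D i \<in> borel_measurable M" for i
    using indep by (auto simp: indep_vars_def)
  define A where "A i = sigma_sets (space M) {D i -` S \<inter> space M | S. S \<in> sets borel}" for i
  have sub: "A i \<subseteq> sets M" for i
    unfolding A_def using D by (intro sets.sigma_sets_subset) auto
  show ?thesis
  proof (rule kolmogorov_0_1_law[of A])
    show "sigma_algebra (space M) (A i)" for i
      unfolding A_def by (intro sigma_algebra_sigma_sets) auto
    show "indep_sets A UNIV"
      using indep by (simp add: indep_vars_def A_def[abs_def])
    \<comment> \<open>Dropping the first \<open>n0\<close> increments shifts all later sums by one
      constant and leaves out finitely many sums, so boundedness above depends only on the
      increments from \<open>n0\<close> on.\<close>
    show "B \<in> tail_events A"
      unfolding tail_events_def
    proof
      fix n0
      define N where "N = sigma (space M) (\<Union> (A ` {n0..}))"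
      have Pow: "\<Union> (A ` {n0..}) \<subseteq> Pow (space M)"
        using sub sets.sets_into_space by blast
      have sN [simp]: "space N = space M" by (simp add: N_def space_measure_of[OF Pow])
      have setsN: "sets N = sigma_sets (space M) (\<Union> (A ` {n0..}))"
        by (simp add: N_def sets_measure_of[OF Pow])
      have [measurable]: "D (n0 + i) \<in> borel_measurable N" for i
      proof (rule measurableI)
        fix S :: "real set" assume "S \<in> sets borel"
        then have "D (n0 + i) -` S \<inter> space M \<in> A (n0 + i)" unfolding A_def by blast
        then show "D (n0 + i) -` S \<inter> space N \<in> sets N"
          unfolding setsN sN by (intro sigma_sets.Basic) auto
      qed auto
      have "B = {\<omega>\<in>space N. \<exists>C::nat. \<forall>n. (\<Sum>i<n. D (n0 + i) \<omega>) \<le> real C}"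
        unfolding B_def sN
      proof (intro Collect_cong conj_cong refl iffI)
        fix \<omega>
        have split: "(\<Sum>i<n0 + n. D i \<omega>) = (\<Sum>i<n0. D i \<omega>) + (\<Sum>i<n. D (n0 + i) \<omega>)" for n
          by (induction n) auto
        {
          assume "\<exists>C::nat. \<forall>n. (\<Sum>i<n. D i \<omega>) \<le> real C"
          then obtain C :: nat where C: "\<And>n. (\<Sum>i<n. D i \<omega>) \<le> real C" by blast
          obtain C' :: nat where "real C - (\<Sum>i<n0. D i \<omega>) \<le> real C'" using real_arch_simple by blast
          then have "(\<Sum>i<n. D (n0 + i) \<omega>) \<le> real C'" for n using C[of "n0 + n"] split[of n] by simp
          then show "\<exists>C::nat. \<forall>n. (\<Sum>i<n. D (n0 + i) \<omega>) \<le> real C" by blast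
        }
        {
          assume "\<exists>C::nat. \<forall>n. (\<Sum>i<n. D (n0 + i) \<omega>) \<le> real C"
          then obtain C :: nat where C: "\<And>n. (\<Sum>i<n. D (n0 + i) \<omega>) \<le> real C" by blast
          obtain C' :: nat where C': "max (real C + (\<Sum>i<n0. D i \<omega>)) (Max ((\<lambda>n. \<Sum>i<n. D i \<omega>) ` {..n0})) \<le> real C'"
            using real_arch_simple by blast
          have "(\<Sum>i<n. D i \<omega>) \<le> real C'" for n
          proof (cases "n \<le> n0")
            case True
            then have "(\<Sum>i<n. D i \<omega>) \<le> Max ((\<lambda>n. \<Sum>i<n. D i \<omega>) ` {..n0})"
              by (intro Max_ge) auto
            with C' show ?thesis by linarith
          next
            case False
            then show ?thesis using split[of "n - n0"] C[of "n - n0"] C' by simp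
          qed
          then show "\<exists>C::nat. \<forall>n. (\<Sum>i<n. D i \<omega>) \<le> real C" by blast
        }
      qed
      also have "\<dots> \<in> sets N" by measurable
      finally show "B \<in> sigma_sets (space M) (\<Union> (A ` {n0..}))" by (simp add: setsN)
    qed
  qed
qed

end

text \<open>Uses 1 - cos s = 2 sin(s/2)^2 together with sin x \<ge> x/2 on (0, 1], where the
  derivative is at least cos(\<pi>/3) = 1/2. It serves to dominate truncated second moments by E(1 -
  cos(tD)).\<close>

lemma one_minus_cos_ge:
  fixes s :: real
  assumes "\<bar>s\<bar> \<le> 2"
  shows "s\<^sup>2 / 8 \<le> 1 - cos s"
proof -
  have sin: "x / 2 \<le> sin x" if x: "0 < x" "x \<le> 1" for x :: real
  proof -
    obtain z where z: "0 < z" "z < x" "sin x - sin 0 = (x - 0) * cos z"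
      using MVT2[of 0 x sin cos] x by (auto intro: derivative_intros)
    have "1 / 2 = cos (pi / 3)" by (simp add: cos_60)
    also have "\<dots> \<le> cos z" using z x pi_gt3 by (intro cos_monotone_0_pi_le) auto
    finally have "x * (1 / 2) \<le> x * cos z" using x by (intro mult_left_mono) auto
    with z show ?thesis by simp
  qed
  have "(s / 4)\<^sup>2 \<le> (sin (s / 2))\<^sup>2"
  proof (cases "s = 0")
    case False
    have "\<bar>s\<bar> / 2 / 2 \<le> sin (\<bar>s\<bar> / 2)" using sin[of "\<bar>s\<bar> / 2"] False assms by simp
    then have "(\<bar>s\<bar> / 4)\<^sup>2 \<le> (sin (\<bar>s\<bar> / 2))\<^sup>2" by (intro power_mono) auto
    then show ?thesis by (cases "0 \<le> s") (auto simp: power_divide)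
  qed simp
  moreover have "cos s = 1 - 2 * (sin (s / 2))\<^sup>2"
    using cos_double_sin[of "s / 2"] by simp
  ultimately show ?thesis by (simp add: power_divide)
qed

text \<open>From x \<le> e^(-(1 - x)), products bounded below by \<open>c\<close> bound the partial
  sums of \<open>1 - x i\<close> by \<open>- ln c\<close>. The lower bound also makes every factor
  positive, so that the products can be compared factor by factor.\<close>

lemma summable_one_minus_if_prod_ge:
  fixes x :: "nat \<Rightarrow> real"
  assumes c: "0 < c" "\<And>n. c \<le> (\<Prod>i<n. x i)" and le: "\<And>i. x i \<le> 1"
  shows "summable (\<lambda>i. 1 - x i)"
proof (rule bounded_imp_summable)
  have pos: "0 < x i" for i
  proof -
    have "0 < (\<Prod>j<i. x j)" "0 < (\<Prod>j<Suc i. x j)" using c by (meson less_le_trans)+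
    then show ?thesis by (simp add: zero_less_mult_iff)
  qed
  fix n
  have "c \<le> (\<Prod>i<Suc n. x i)" by (rule c)
  also have "\<dots> \<le> (\<Prod>i<Suc n. exp (- (1 - x i)))"
    using pos exp_ge_add_one_self by (intro prod_mono) (smt (verit) less_imp_le)
  also have "\<dots> = exp (- (\<Sum>i<Suc n. 1 - x i))"
    by (simp only: exp_sum[symmetric, OF finite_lessThan] sum_negf)
  finally have "ln c \<le> ln (exp (- (\<Sum>i<Suc n. 1 - x i)))"
    using c(1) by (subst ln_le_cancel_iff) auto
  then show "(\<Sum>i\<le>n. 1 - x i) \<le> - ln c" by (simp only: lessThan_Suc_atMost ln_exp)
qed (use le in auto)

context prob_space
begin

text \<open>For symmetric variables the characteristic function is real and equals the mean of the
  cosine, so its multiplicativity becomes a product formula for cosines.\<close>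

lemma expectation_cos_sum_symmetric:
  fixes D :: "nat \<Rightarrow> 'a \<Rightarrow> real"
  assumes indep: "indep_vars (\<lambda>_. borel) D UNIV"
    and sym: "\<And>i. distr M borel (D i) = distr M borel (\<lambda>\<omega>. - D i \<omega>)"
  shows "expectation (\<lambda>\<omega>. cos (t * (\<Sum>i<n. D i \<omega>))) = (\<Prod>i<n. expectation (\<lambda>\<omega>. cos (t * D i \<omega>)))"
proof -
  have [measurable]: "D i \<in> borel_measurable M" for i
    using indep by (auto simp: indep_vars_def)
  have int: "integrable M (\<lambda>\<omega>. iexp (t * X \<omega>))" if [measurable]: "X \<in> borel_measurable M" for X
    by (rule integrable_const_bound[where B = 1]) auto
  have ch: "char (distr M borel X) t = expectation (\<lambda>\<omega>. iexp (t * X \<omega>))"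
    if [measurable]: "X \<in> borel_measurable M" for X
    unfolding char_def by (subst integral_distr) auto
  have Re: "Re (char (distr M borel X) t) = expectation (\<lambda>\<omega>. cos (t * X \<omega>))"
    if [measurable]: "X \<in> borel_measurable M" for X
    using integral_Re[OF int[OF that]] by (simp add: ch Re_exp)
  have Im: "Im (char (distr M borel X) t) = expectation (\<lambda>\<omega>. sin (t * X \<omega>))"
    if [measurable]: "X \<in> borel_measurable M" for X
    using integral_Im[OF int[OF that]] by (simp add: ch Im_exp)
  have "expectation (\<lambda>\<omega>. sin (t * D i \<omega>)) = 0" for i
    by (rule expectation_symmetric_odd[of "D i" "\<lambda>x. sin (t * x)", OF _ _ sym]) auto
  then have "char (distr M borel (D i)) t = complex_of_real (expectation (\<lambda>\<omega>. cos (t * D i \<omega>)))" for i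
    by (intro complex_eqI) (simp_all add: Re Im)
  then have "char (distr M borel (\<lambda>\<omega>. \<Sum>i<n. D i \<omega>)) t =
      complex_of_real (\<Prod>i<n. expectation (\<lambda>\<omega>. cos (t * D i \<omega>)))"
    by (subst char_distr_sum[OF indep_vars_subset[OF indep]]) auto
  then show ?thesis using Re[of "\<lambda>\<omega>. \<Sum>i<n. D i \<omega>"] by (simp del: of_real_prod)
qed

text \<open>If the partial sums were bounded above with positive probability, then by the zero-one law and
  symmetry they would be bounded almost surely, hence tight; so \<open>\<Prod>\<^sub>i E cos (t D\<^sub>i)\<close> stays away from 0 for
  small \<open>t\<close>, the truncated increments have summable variances, and the series converges.\<close>

lemma AE_unbounded_above_if_not_summable:
  fixes D :: "nat \<Rightarrow> 'a \<Rightarrow> real"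
  assumes indep: "indep_vars (\<lambda>_. borel) D UNIV"
    and sym: "\<And>i. distr M borel (D i) = distr M borel (\<lambda>\<omega>. - D i \<omega>)"
    and div: "AE \<omega> in M. \<not> summable (\<lambda>i. D i \<omega>)"
  shows "AE \<omega> in M. \<forall>C. \<exists>n. C < (\<Sum>i<n. D i \<omega>)"
proof -
  have [measurable]: "D i \<in> borel_measurable M" for i
    using indep by (auto simp: indep_vars_def)
  let ?W = "\<lambda>n \<omega>. \<Sum>i<n. D i \<omega>"
  define B where "B = {\<omega>\<in>space M. \<exists>C::nat. \<forall>n. ?W n \<omega> \<le> real C}"
  have [measurable]: "B \<in> sets M" unfolding B_def by measurable
  have "prob B \<noteq> 1"
  proof
    assume B1: "prob B = 1"
    define P where "P z \<longleftrightarrow> (\<exists>C::nat. \<forall>n. (\<Sum>i<n. z i) \<le> real C)" for z :: "nat \<Rightarrow> real"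
    have mP: "Measurable.pred (PiM UNIV (\<lambda>_. borel)) P" unfolding P_def by measurable
    have "\<P>(\<omega> in M. P (flip_from 0 (\<lambda>i. D i \<omega>))) = 1"
      using prob_flip_from[OF indep sym mP, of 0] B1 by (simp add: P_def B_def)
    then have "AE \<omega> in M. P (flip_from 0 (\<lambda>i. D i \<omega>))"
      by (subst (asm) prob_eq_1) (auto simp: P_def sum_flip_from_ge)
    moreover have "AE \<omega> in M. P (\<lambda>i. D i \<omega>)"
      using B1 unfolding B_def by (subst (asm) prob_eq_1) (auto simp: P_def)
    ultimately have bdd: "AE \<omega> in M. \<exists>C::nat. \<forall>n. \<bar>?W n \<omega>\<bar> \<le> real C"
    proof eventually_elim
      case (elim \<omega>)
      then obtain C1 C2 :: nat where C12: "\<And>n. - ?W n \<omega> \<le> real C1" "\<And>n. ?W n \<omega> \<le> real C2"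
        by (auto simp: P_def sum_flip_from_ge)
      have "\<bar>?W n \<omega>\<bar> \<le> real (max C1 C2)" for n
        using C12[of n] unfolding of_nat_max by linarith
      then show ?case by blast
    qed
    define G where "G C = {\<omega>\<in>space M. \<forall>n. \<bar>?W n \<omega>\<bar> \<le> real C}" for C :: nat
    have [measurable]: "G C \<in> sets M" for C unfolding G_def by measurable
    have "(\<lambda>C. prob (G C)) \<longlonglongrightarrow> prob (\<Union>C. G C)"
      by (intro finite_Lim_measure_incseq) (auto simp: incseq_def G_def intro: order_trans)
    moreover have "prob (\<Union>C. G C) = 1"
      using bdd AE_space by (subst prob_eq_1) (auto simp: G_def)
    \<comment> \<open>With \<open>9 / 10\<close> the lower bound for the mean cosine becomes
      \<open>9 / 10 * (3 / 2) - 1 = 7 / 20\<close>, which is above \<open>1 / 3\<close>.\<close>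
    ultimately have "\<forall>\<^sub>F C in sequentially. 9 / 10 < prob (G C)"
      by (intro order_tendstoD) auto
    then obtain C where C: "9 / 10 < prob (G C)" "1 \<le> C"
      using eventually_conj[OF _ eventually_ge_at_top[of 1]] by (metis (no_types, lifting) eventually_sequentially le_refl)
    define t where "t = 1 / real C"
    have t: "0 < t" "t * real C = 1" using C by (auto simp: t_def)
    define \<theta> where "\<theta> i = expectation (\<lambda>\<omega>. cos (t * D i \<omega>))" for i
    have intc: "integrable M (\<lambda>\<omega>. cos (t * X \<omega>))" if [measurable]: "X \<in> borel_measurable M" for X
      by (rule integrable_const_bound[where B = 1]) auto
    have "1 / 3 \<le> (\<Prod>i<n. \<theta> i)" for n
    proof -
      have cos1: "1 / 2 \<le> cos (t * w)" if "\<bar>w\<bar> \<le> real C" for w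
      proof -
        have "\<bar>t * w\<bar> \<le> 1" using that t by (metis abs_mult abs_of_pos mult_left_mono less_imp_le)
        then have "cos (pi / 3) \<le> cos \<bar>t * w\<bar>"
          using pi_gt3 by (intro cos_monotone_0_pi_le) auto
        then show ?thesis by (simp add: cos_60)
      qed
      \<comment> \<open>The minorant of the cosine is 1/2 on \<open>G C\<close>, where the argument
        is at most 1 in absolute value, and the trivial -1 elsewhere.\<close>
      have "9 / 10 * (3 / 2) - 1 \<le> prob (G C) * (3 / 2) - 1" using C by simp
      also have "\<dots> = expectation (\<lambda>\<omega>. indicator (G C) \<omega> * (3 / 2) - 1)"
        by (subst Bochner_Integration.integral_diff) (auto simp: prob_space emeasure_eq_measure)
      also have "\<dots> \<le> expectation (\<lambda>\<omega>. cos (t * ?W n \<omega>))"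
      proof (intro integral_mono intc)
        fix \<omega> assume "\<omega> \<in> space M"
        show "indicator (G C) \<omega> * (3 / 2) - 1 \<le> cos (t * ?W n \<omega>)"
          using cos1[of "?W n \<omega>"] cos_ge_minus_one[of "t * ?W n \<omega>"]
          by (cases "\<omega> \<in> G C") (auto simp: G_def)
      qed (auto simp: emeasure_eq_measure)
      also have "\<dots> = (\<Prod>i<n. \<theta> i)"
        unfolding \<theta>_def by (rule expectation_cos_sum_symmetric[OF indep sym])
      finally show ?thesis by simp
    qed
    moreover have "\<theta> i \<le> 1" for i
    proof -
      have "\<theta> i \<le> expectation (\<lambda>_. 1)" unfolding \<theta>_def by (intro integral_mono intc) auto
      then show ?thesis by (simp add: prob_space)
    qed
    ultimately have summ: "summable (\<lambda>i. 1 - \<theta> i)"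
      by (intro summable_one_minus_if_prod_ge[of "1 / 3"]) auto
    \<comment> \<open>On \<open>G C\<close> every increment, as a difference of two sums bounded by
      \<open>C\<close>, is at most \<open>2 * real C\<close> in absolute value, so the truncation
      has no effect there. It also keeps \<open>t * x\<close> in [-2, 2], the range of the cosine
      estimate.\<close>
    define h where "h x = (if \<bar>x\<bar> \<le> 2 * real C then x else 0)" for x :: real
    have [measurable]: "h \<in> borel_measurable borel" unfolding h_def by measurable
    have h2: "(h x)\<^sup>2 \<le> 8 * (real C)\<^sup>2 * (1 - cos (t * x))" for x
    proof (cases "\<bar>x\<bar> \<le> 2 * real C")
      case True
      have "\<bar>t * x\<bar> \<le> 2" using True t C by (simp add: t_def abs_mult divide_le_eq)
      from one_minus_cos_ge[OF this] show ?thesis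
        using True C by (simp add: h_def t_def power_divide power_mult_distrib field_simps)
    next
      case False
      then show ?thesis by (simp add: h_def)
    qed
    have inth: "integrable M (\<lambda>\<omega>. (h (D i \<omega>))\<^sup>2)" for i
    proof (rule integrable_const_bound[where B = "(2 * real C)\<^sup>2"])
      have "\<bar>h x\<bar> \<le> \<bar>2 * real C\<bar>" for x by (simp add: h_def)
      then have "(h x)\<^sup>2 \<le> (2 * real C)\<^sup>2" for x by (simp only: abs_le_square_iff)
      then show "AE \<omega> in M. norm ((h (D i \<omega>))\<^sup>2) \<le> (2 * real C)\<^sup>2"
        by (intro AE_I2) simp
    qed auto
    have "AE \<omega> in M. summable (\<lambda>i. h (D i \<omega>))"
    proof (rule AE_summable_symmetric)
      show "indep_vars (\<lambda>_. borel) (\<lambda>i \<omega>. h (D i \<omega>)) UNIV"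
        by (rule indep_vars_compose2[OF indep]) auto
      show "distr M borel (\<lambda>\<omega>. h (D i \<omega>)) = distr M borel (\<lambda>\<omega>. - h (D i \<omega>))" for i
        by (rule distr_symmetric_odd[OF _ _ sym]) (auto simp: h_def)
      have "expectation (\<lambda>\<omega>. (h (D i \<omega>))\<^sup>2) \<le> 8 * (real C)\<^sup>2 * (1 - \<theta> i)" for i
      proof -
        have "expectation (\<lambda>\<omega>. (h (D i \<omega>))\<^sup>2) \<le> expectation (\<lambda>\<omega>. 8 * (real C)\<^sup>2 * (1 - cos (t * D i \<omega>)))"
          using h2 by (intro integral_mono inth integrable_mult_right Bochner_Integration.integrable_diff intc) auto
        also have "\<dots> = 8 * (real C)\<^sup>2 * (1 - \<theta> i)"
          by (simp add: \<theta>_def intc prob_space)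
        finally show ?thesis .
      qed
      then show "summable (\<lambda>i. expectation (\<lambda>\<omega>. (h (D i \<omega>))\<^sup>2))"
        by (intro summable_comparison_test'[OF summable_mult[OF summ, of "8 * (real C)\<^sup>2"], of 0]) simp
    qed (rule inth)
    with div have "AE \<omega> in M. \<omega> \<notin> G C"
    proof eventually_elim
      case (elim \<omega>)
      show ?case
      proof
        assume "\<omega> \<in> G C"
        then have W: "\<bar>?W n \<omega>\<bar> \<le> real C" for n by (simp add: G_def)
        have "h (D i \<omega>) = D i \<omega>" for i
          using W[of i] W[of "Suc i"] by (auto simp: h_def)
        with elim show False by simp
      qed
    qed
    then have "prob (G C) = 0" by (subst prob_eq_0) auto
    with C show False by simp
  qed
  then have "prob B = 0" using bounded_above_0_1[OF indep] by (simp add: B_def)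
  then have "AE \<omega> in M. \<omega> \<notin> B" by (subst (asm) prob_eq_0) auto
  then show ?thesis
    using AE_space
  proof eventually_elim
    case (elim \<omega>)
    show ?case
    proof
      fix C
      obtain C' :: nat where "C \<le> real C'" using real_arch_simple by blast
      moreover obtain n where "\<not> ?W n \<omega> \<le> real C'" using elim by (auto simp: B_def)
      ultimately show "\<exists>n. C < ?W n \<omega>" by (intro exI[of _ n]) auto
    qed
  qed
qed

end

section \<open>Independent waiting times\<close>

lemma (in prob_space) indep_vars_pairs:
  fixes X :: "'u \<Rightarrow> 'j \<Rightarrow> 'a \<Rightarrow> 'b :: topological_space"
  assumes meas [measurable]: "\<And>u j. X u j \<in> borel_measurable M"
    and nodes: "indep_vars (\<lambda>_. PiM UNIV (\<lambda>_. borel)) (\<lambda>u \<omega> j. X u j \<omega>) UNIV"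
    and ident: "\<And>u. distr M (PiM UNIV (\<lambda>_. borel)) (\<lambda>\<omega> j. X u j \<omega>) =
                     distr M (PiM UNIV (\<lambda>_. borel)) (\<lambda>\<omega> j. X r j \<omega>)"
    and row: "indep_vars (\<lambda>_. borel) (\<lambda>j. X r j) UNIV"
  shows "indep_vars (\<lambda>_. borel) (\<lambda>p. X (fst p) (snd p)) UNIV"
proof -
  have seq [measurable]: "(\<lambda>\<omega> j. X u j \<omega>) \<in> measurable M (PiM UNIV (\<lambda>_. borel))" for u
    by (intro measurable_PiM_single') auto
  have eqr: "\<P>(\<omega> in M. (\<lambda>j. X u j \<omega>) \<in> S) = \<P>(\<omega> in M. (\<lambda>j. X r j \<omega>) \<in> S)"
    if [measurable]: "S \<in> sets (PiM UNIV (\<lambda>_. borel))" for S u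
  proof -
    have "measure (distr M (PiM UNIV (\<lambda>_. borel)) (\<lambda>\<omega> j. X u j \<omega>)) S =
          measure (distr M (PiM UNIV (\<lambda>_. borel)) (\<lambda>\<omega> j. X r j \<omega>)) S"
      by (simp only: ident[of u])
    then show ?thesis
      by (subst (asm) (1 2) measure_distr) (auto simp: vimage_def Int_def conj_commute)
  qed
  show ?thesis
    unfolding indep_vars_def2
  proof (intro conjI ballI indep_setsI)
    fix A J assume J: "J \<noteq> {}" "J \<subseteq> (UNIV :: ('u \<times> 'j) set)" "finite J"
      and A: "\<forall>p\<in>J. A p \<in> {X (fst p) (snd p) -` S \<inter> space M |S. S \<in> sets borel}"
    then have "\<forall>p\<in>J. \<exists>S. S \<in> sets borel \<and> A p = X (fst p) (snd p) -` S \<inter> space M" by blast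
    then obtain S where S: "\<And>p. p \<in> J \<Longrightarrow> S p \<in> sets borel"
      "\<And>p. p \<in> J \<Longrightarrow> A p = X (fst p) (snd p) -` S p \<inter> space M" by metis
    \<comment> \<open>\<open>J\<close> is enlarged to the rectangle \<open>U \<times> V\<close>; the
      added coordinates carry the trivial event \<open>UNIV\<close> and contribute factors
      1.\<close>
    define S' where "S' p = (if p \<in> J then S p else UNIV)" for p
    have S' [measurable]: "S' p \<in> sets borel" for p by (simp add: S'_def S)
    define U V where "U = fst ` J" and "V = snd ` J"
    have UV: "finite U" "finite V" "U \<noteq> {}" "V \<noteq> {}" "J \<subseteq> U \<times> V"
      using J by (force simp: U_def V_def)+
    define Q where "Q u = {f. \<forall>j\<in>V. f j \<in> S' (u, j)}" for u
    have Q [measurable]: "Q u \<in> sets (PiM UNIV (\<lambda>_. borel))" for u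
    proof -
      have "{f \<in> space (PiM UNIV (\<lambda>_. borel)). \<forall>j\<in>V. f j \<in> S' (u, j)} \<in> sets (PiM UNIV (\<lambda>_. borel :: 'b measure))"
        using UV by measurable
      then show ?thesis by (simp add: Q_def space_PiM)
    qed
    have "(\<Inter>p\<in>J. A p) = (\<Inter>u\<in>U. (\<lambda>\<omega> j. X u j \<omega>) -` Q u \<inter> space M)"
    proof (intro set_eqI iffI)
      fix \<omega> assume \<omega>: "\<omega> \<in> (\<Inter>p\<in>J. A p)"
      then have "\<omega> \<in> space M" using J S by blast
      moreover have "X u j \<omega> \<in> S' (u, j)" for u j
        using \<omega> S(2)[of "(u, j)"] by (auto simp: S'_def)
      ultimately show "\<omega> \<in> (\<Inter>u\<in>U. (\<lambda>\<omega> j. X u j \<omega>) -` Q u \<inter> space M)"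
        by (auto simp: Q_def)
    next
      fix \<omega> assume \<omega>: "\<omega> \<in> (\<Inter>u\<in>U. (\<lambda>\<omega> j. X u j \<omega>) -` Q u \<inter> space M)"
      show "\<omega> \<in> (\<Inter>p\<in>J. A p)"
      proof
        fix p assume p: "p \<in> J"
        then have uv: "fst p \<in> U" "snd p \<in> V" by (auto simp: U_def V_def)
        with \<omega> have "\<omega> \<in> (\<lambda>\<omega> j. X (fst p) j \<omega>) -` Q (fst p) \<inter> space M" by blast
        with uv have "\<omega> \<in> space M" "X (fst p) (snd p) \<omega> \<in> S' p" by (auto simp: Q_def)
        then show "\<omega> \<in> A p" using p S(2)[OF p] by (simp add: S'_def)
      qed
    qed
    then have "prob (\<Inter>p\<in>J. A p) = (\<Prod>u\<in>U. prob ((\<lambda>\<omega> j. X u j \<omega>) -` Q u \<inter> space M))"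
      using indep_varsD[OF nodes, of U Q] UV by simp
    also have "\<dots> = (\<Prod>u\<in>U. \<Prod>j\<in>V. \<P>(\<omega> in M. X u j \<omega> \<in> S' (u, j)))"
    proof (intro prod.cong refl)
      fix u
      have "prob ((\<lambda>\<omega> j. X u j \<omega>) -` Q u \<inter> space M) = \<P>(\<omega> in M. (\<lambda>j. X u j \<omega>) \<in> Q u)"
        by (simp add: vimage_def Int_def conj_commute)
      also have "\<dots> = \<P>(\<omega> in M. (\<lambda>j. X r j \<omega>) \<in> Q u)" by (rule eqr) simp
      also have "\<dots> = prob (\<Inter>j\<in>V. X r j -` S' (u, j) \<inter> space M)"
        using UV by (intro arg_cong[where f = prob]) (auto simp: Q_def)
      also have "\<dots> = (\<Prod>j\<in>V. prob (X r j -` S' (u, j) \<inter> space M))"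
        using UV by (intro indep_varsD[OF row]) auto
      also have "\<dots> = (\<Prod>j\<in>V. \<P>(\<omega> in M. X u j \<omega> \<in> S' (u, j)))"
      proof (intro prod.cong refl)
        fix j
        have "{f \<in> space (PiM UNIV (\<lambda>_. borel)). f j \<in> S' (u, j)} \<in> sets (PiM UNIV (\<lambda>_. borel :: 'b measure))"
          by measurable
        then have "{f. f j \<in> S' (u, j)} \<in> sets (PiM UNIV (\<lambda>_. borel :: 'b measure))"
          by (simp add: space_PiM)
        from eqr[OF this, of u]
        show "prob (X r j -` S' (u, j) \<inter> space M) = \<P>(\<omega> in M. X u j \<omega> \<in> S' (u, j))"
          by (simp add: vimage_def Int_def conj_commute)
      qed
      finally show "prob ((\<lambda>\<omega> j. X u j \<omega>) -` Q u \<inter> space M) = (\<Prod>j\<in>V. \<P>(\<omega> in M. X u j \<omega> \<in> S' (u, j)))" .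
    qed
    also have "\<dots> = (\<Prod>p\<in>U \<times> V. \<P>(\<omega> in M. X (fst p) (snd p) \<omega> \<in> S' p))"
      by (simp add: prod.cartesian_product case_prod_beta)
    also have "\<dots> = (\<Prod>p\<in>J. \<P>(\<omega> in M. X (fst p) (snd p) \<omega> \<in> S' p))"
      using UV by (intro prod.mono_neutral_right) (auto simp: S'_def prob_space)
    also have "\<dots> = (\<Prod>p\<in>J. prob (A p))"
      by (intro prod.cong refl) (simp add: S S'_def vimage_def Int_def conj_commute)
    finally show "prob (\<Inter>p\<in>J. A p) = (\<Prod>p\<in>J. prob (A p))" .
  qed auto
qed

locale waiting_times = prob_space M for M :: "'a measure" +
  fixes x :: "nat list \<Rightarrow> nat \<Rightarrow> 'a \<Rightarrow> real"
  assumes x_nonneg: "\<And>u j \<omega>. 0 \<le> x u j \<omega>"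
    and x_indep: "indep_vars (\<lambda>_. borel) (\<lambda>p. x (fst p) (snd p)) UNIV"
    and x_ident: "\<And>u j. distr M borel (x u j) = distr M borel (x [] j)"
begin

lemma x_measurable [measurable]: "x u j \<in> borel_measurable M"
  using x_indep by (auto simp: indep_vars_def)

text \<open>The functionals \<open>g i\<close> act on the whole array, and \<open>dep\<close>
  expresses that only the block \<open>K i\<close> matters, since zeroing all other entries changes
  nothing. Users can thus write down differences of birth times directly, without products over
  restricted index sets.\<close>

lemma indep_vars_disjoint_blocks:
  fixes g :: "'i \<Rightarrow> (nat list \<times> nat \<Rightarrow> real) \<Rightarrow> real"
  assumes K: "disjoint_family K"
    and g: "\<And>i. g i \<in> borel_measurable (PiM UNIV (\<lambda>_. borel))"
    and dep: "\<And>i z. g i (\<lambda>p. if p \<in> K i then z p else 0) = g i z"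
  shows "indep_vars (\<lambda>_. borel) (\<lambda>i \<omega>. g i (\<lambda>p. x (fst p) (snd p) \<omega>)) UNIV"
proof -
  have "indep_vars (\<lambda>i. PiM (K i) (\<lambda>_. borel)) (\<lambda>i \<omega>. restrict (\<lambda>p. x (fst p) (snd p) \<omega>) (K i)) UNIV"
    using K by (intro indep_vars_restrict[OF x_indep]) auto
  then have "indep_vars (\<lambda>_. borel) (\<lambda>i \<omega>. (\<lambda>z. g i (\<lambda>p. if p \<in> K i then z p else 0))
      (restrict (\<lambda>p. x (fst p) (snd p) \<omega>) (K i))) UNIV"
  proof (rule indep_vars_compose2)
    fix i
    have "(\<lambda>z p. if p \<in> K i then z p else 0) \<in> measurable (PiM (K i) (\<lambda>_. borel)) (PiM UNIV (\<lambda>_. borel :: real measure))"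
    proof (rule measurable_PiM_single')
      fix p show "(\<lambda>z. if p \<in> K i then z p else 0) \<in> borel_measurable (PiM (K i) (\<lambda>_. borel :: real measure))"
        by (cases "p \<in> K i") auto
    qed auto
    from measurable_compose[OF this g[of i]]
    show "(\<lambda>z. g i (\<lambda>p. if p \<in> K i then z p else 0)) \<in> borel_measurable (PiM (K i) (\<lambda>_. borel))" .
  qed
  moreover have "g i (\<lambda>p. if p \<in> K i then restrict (\<lambda>p. x (fst p) (snd p) \<omega>) (K i) p else 0) =
      g i (\<lambda>p. x (fst p) (snd p) \<omega>)" for i \<omega>
    using dep[of i "\<lambda>p. x (fst p) (snd p) \<omega>"] by (simp cong: if_cong)
  ultimately show ?thesis by simp
qed

lemma distr_x_pair:
  assumes "u \<noteq> v"
  shows "distr M (borel \<Otimes>\<^sub>M borel) (\<lambda>\<omega>. (x u j \<omega>, x v j \<omega>)) =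
         distr M borel (x [] j) \<Otimes>\<^sub>M distr M borel (x [] j)"
proof -
  define g where "g b z = z (if b then u else v, j)" for b and z :: "nat list \<times> nat \<Rightarrow> real"
  have "indep_vars (\<lambda>_. borel) (\<lambda>i \<omega>. g i (\<lambda>p. x (fst p) (snd p) \<omega>)) UNIV"
    by (rule indep_vars_disjoint_blocks[where K = "\<lambda>b. {(if b then u else v, j)}"])
       (use assms in \<open>auto simp: disjoint_family_on_def g_def[abs_def]\<close>)
  then have "indep_vars (\<lambda>_. borel) (case_bool (x u j) (x v j)) UNIV"
    by (rule indep_vars_cong[THEN iffD1, rotated -1]) (auto simp: g_def fun_eq_iff split: bool.split)
  then have "indep_var borel (x u j) borel (x v j)"
    unfolding indep_var_def by (rule indep_vars_cong[THEN iffD1, rotated -1]) (auto split: bool.split)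
  then show ?thesis
    by (simp add: indep_var_distribution_eq x_ident[of u j] x_ident[of v j])
qed

text \<open>For distinct nodes the two entries are independent with the same law, so their joint law
  is unchanged by swapping \<open>u\<close> and \<open>v\<close>.\<close>

lemma x_diff_symmetric:
  "distr M borel (\<lambda>\<omega>. x u j \<omega> - x v j \<omega>) = distr M borel (\<lambda>\<omega>. - (x u j \<omega> - x v j \<omega>))"
proof (cases "u = v")
  case False
  have "distr M borel (\<lambda>\<omega>. x u j \<omega> - x v j \<omega>) =
      distr (distr M (borel \<Otimes>\<^sub>M borel) (\<lambda>\<omega>. (x u j \<omega>, x v j \<omega>))) borel (\<lambda>p. fst p - snd p)"
    by (subst distr_distr) (auto simp: comp_def)
  also have "\<dots> = distr (distr M (borel \<Otimes>\<^sub>M borel) (\<lambda>\<omega>. (x v j \<omega>, x u j \<omega>))) borel (\<lambda>p. fst p - snd p)"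
    by (simp only: distr_x_pair[OF False] distr_x_pair[OF False[symmetric]])
  also have "\<dots> = distr M borel (\<lambda>\<omega>. - (x u j \<omega> - x v j \<omega>))"
    by (subst distr_distr) (auto simp: comp_def)
  finally show ?thesis .
qed simp

lemma x_diff_indep:
  assumes "u \<noteq> v"
  shows "indep_vars (\<lambda>_. borel) (\<lambda>j \<omega>. x u j \<omega> - x v j \<omega>) UNIV"
proof -
  define g where "g j z = z (u, j) - z (v, j)" for j and z :: "nat list \<times> nat \<Rightarrow> real"
  have "indep_vars (\<lambda>_. borel) (\<lambda>i \<omega>. g i (\<lambda>p. x (fst p) (snd p) \<omega>)) UNIV"
    by (rule indep_vars_disjoint_blocks[where K = "\<lambda>j. {(u, j), (v, j)}"])
       (use assms in \<open>auto simp: disjoint_family_on_def g_def[abs_def]\<close>)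
  then show ?thesis by (simp add: g_def)
qed

end

section \<open>Exponential moments and persistent hubs\<close>

lemma sum_prod_list_lists_length:
  fixes r :: "nat \<Rightarrow> ennreal"
  shows "(\<Sum>w | set w \<subseteq> {..<m} \<and> length w = n. prod_list (map r w)) = (\<Sum>j<m. r j) ^ n"
proof (induction n)
  case 0
  have "{w :: nat list. set w \<subseteq> {..<m} \<and> length w = 0} = {[]}" by auto
  then show ?case by simp
next
  case (Suc n)
  let ?L = "{w :: nat list. set w \<subseteq> {..<m} \<and> length w = n}"
  have "{w :: nat list. set w \<subseteq> {..<m} \<and> length w = Suc n} = (\<lambda>(j, w). j # w) ` ({..<m} \<times> ?L)"
    by (auto simp: length_Suc_conv image_iff)
  then have "(\<Sum>w | set w \<subseteq> {..<m} \<and> length w = Suc n. prod_list (map r w)) =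
      (\<Sum>(j, w)\<in>{..<m} \<times> ?L. r j * prod_list (map r w))"
    by (simp add: sum.reindex inj_on_def case_prod_beta)
  also have "\<dots> = (\<Sum>j<m. r j) * (\<Sum>w\<in>?L. prod_list (map r w))"
    by (simp add: sum.cartesian_product[symmetric] sum_product)
  finally show ?case by (simp add: Suc)
qed

text \<open>Grouped by length, the words give a geometric series with ratio below 1. The bound is
  uniform over finite sets of words, whose lengths and letters are bounded, so only finite sums are
  rearranged.\<close>

lemma sum_prod_list_le:
  fixes r :: "nat \<Rightarrow> ennreal"
  assumes q: "(\<Sum>j. r j) < 1"
  obtains G where "G < \<infinity>" "\<And>F. finite F \<Longrightarrow> (\<Sum>w\<in>F. prod_list (map r w)) \<le> G"
proof
  obtain q' where q': "0 \<le> q'" "(\<Sum>j. r j) = ennreal q'" "q' < 1"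
    using q by (cases "\<Sum>j. r j") (auto simp: top_unique)
  have "(\<Sum>n. (\<Sum>j. r j) ^ n) = ennreal (\<Sum>n. q' ^ n)"
    using q' by (simp add: ennreal_power suminf_ennreal2 summable_geometric)
  then show "(\<Sum>n. (\<Sum>j. r j) ^ n) < \<infinity>" by simp
  fix F :: "nat list set" assume F: "finite F"
  define N where "N = Suc (Max (insert 0 (length ` F)))"
  define m where "m = Suc (Max (insert 0 (\<Union>w\<in>F. set w)))"
  let ?L = "\<lambda>n. {w :: nat list. set w \<subseteq> {..<m} \<and> length w = n}"
  have finL: "finite (?L n)" for n by (rule finite_lists_length_eq) simp
  have "F \<subseteq> (\<Union>n<N. ?L n)"
  proof
    fix w assume w: "w \<in> F"
    then have "length w < N" unfolding N_def less_Suc_eq_le using F by (intro Max_ge) auto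
    moreover have "j < m" if "j \<in> set w" for j
      unfolding m_def less_Suc_eq_le using F w that by (intro Max_ge) auto
    ultimately show "w \<in> (\<Union>n<N. ?L n)" by auto
  qed
  then have "(\<Sum>w\<in>F. prod_list (map r w)) \<le> (\<Sum>w\<in>(\<Union>n<N. ?L n). prod_list (map r w))"
    using finL by (intro sum_mono2) auto
  also have "\<dots> = (\<Sum>n<N. \<Sum>w\<in>?L n. prod_list (map r w))"
    using finL by (intro sum.UNION_disjoint) auto
  also have "\<dots> = (\<Sum>n<N. (\<Sum>j<m. r j) ^ n)"
    by (simp add: sum_prod_list_lists_length)
  also have "\<dots> \<le> (\<Sum>n<N. (\<Sum>j. r j) ^ n)"
    by (intro sum_mono power_mono sum_le_suminf) auto
  also have "\<dots> \<le> (\<Sum>n. (\<Sum>j. r j) ^ n)"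
    by (intro sum_le_suminf) auto
  finally show "(\<Sum>w\<in>F. prod_list (map r w)) \<le> (\<Sum>n. (\<Sum>j. r j) ^ n)" .
qed

text \<open>The first Borel-Cantelli lemma, moved from natural numbers to countable index types such
  as the nodes by means of an enumeration.\<close>

lemma (in finite_measure) AE_finite_if_sum_emeasure_le:
  fixes E :: "'i :: countable \<Rightarrow> 'a set"
  assumes E [measurable]: "\<And>i. E i \<in> sets M"
    and C: "C < \<infinity>" "\<And>F. finite F \<Longrightarrow> (\<Sum>i\<in>F. emeasure M (E i)) \<le> C"
  shows "AE \<omega> in M. finite {i. \<omega> \<in> E i}"
proof -
  let ?I = "range (to_nat :: 'i \<Rightarrow> nat)"
  define E' where "E' n = (if n \<in> ?I then E (from_nat n) else {})" for n
  have [measurable]: "E' n \<in> sets M" for n by (simp add: E'_def)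
  have "(\<Sum>n\<le>N. measure M (E' n)) \<le> enn2real C" for N
  proof -
    have "(\<Sum>n\<le>N. emeasure M (E' n)) = (\<Sum>n\<in>{..N} \<inter> ?I. emeasure M (E (from_nat n)))"
      by (intro sum.mono_neutral_cong_right) (auto simp: E'_def)
    also have "\<dots> = (\<Sum>i\<in>from_nat ` ({..N} \<inter> ?I). emeasure M (E i))"
      by (subst sum.reindex) (auto simp: inj_on_def)
    also have "\<dots> \<le> C" by (intro C) auto
    finally have "ennreal (\<Sum>n\<le>N. measure M (E' n)) \<le> C"
      by (simp add: emeasure_eq_measure)
    then show ?thesis using C(1) by (cases C) (auto simp: sum_nonneg)
  qed
  then have "summable (\<lambda>n. measure M (E' n))"
    by (intro bounded_imp_summable) auto
  then have "AE \<omega> in M. eventually (\<lambda>n. \<omega> \<in> space M - E' n) sequentially"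
    by (intro borel_cantelli_AE1) (auto simp: emeasure_eq_measure)
  then show ?thesis
  proof eventually_elim
    case (elim \<omega>)
    then obtain N where "\<And>n. N \<le> n \<Longrightarrow> \<omega> \<notin> E' n" by (auto simp: eventually_sequentially)
    moreover have "E' (to_nat i) = E i" for i by (simp add: E'_def)
    ultimately have "to_nat i < N" if "\<omega> \<in> E i" for i
      using that by (metis not_le)
    then have "{i. \<omega> \<in> E i} \<subseteq> to_nat -` {..<N}" by auto
    then show ?case by (rule finite_subset) (intro finite_vimageI, auto)
  qed
qed

text \<open>The waiting times that add up to the birth time of \<open>w\<close>, without those of the first \<open>a\<close> ancestors.\<close>

definition anc :: "nat \<Rightarrow> nat list \<Rightarrow> (nat list \<times> nat) set" where
  "anc a w = (\<Union>k\<in>{a..<length w}. {take k w} \<times> {..w ! k})"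

lemma finite_anc [simp]: "finite (anc a w)"
  by (simp add: anc_def)

lemma take_inj: "take k w = take l w \<Longrightarrow> k < length w \<Longrightarrow> l < length w \<Longrightarrow> k = l"
  by (metis length_take min.absorb4)

lemma sum_anc:
  "(\<Sum>p\<in>anc a w. f p) = (\<Sum>k\<in>{a..<length w}. \<Sum>j\<le>w ! k. f (take k w, j))"
proof -
  have "(\<Sum>p\<in>anc a w. f p) = (\<Sum>k\<in>{a..<length w}. \<Sum>p\<in>{take k w} \<times> {..w ! k}. f p)"
    unfolding anc_def by (intro sum.UNION_disjoint) (auto dest: take_inj)
  moreover have "(\<Sum>p\<in>{u} \<times> S. f p) = (\<Sum>j\<in>S. f (u, j))" for u and S :: "nat set"
    by (intro sum.reindex_bij_witness[of _ "Pair u" snd]) auto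
  ultimately show ?thesis by simp
qed

lemma prod_anc:
  "(\<Prod>p\<in>anc a w. f p) = (\<Prod>k\<in>{a..<length w}. \<Prod>j\<le>w ! k. f (take k w, j))"
proof -
  have "(\<Prod>p\<in>anc a w. f p) = (\<Prod>k\<in>{a..<length w}. \<Prod>p\<in>{take k w} \<times> {..w ! k}. f p)"
    unfolding anc_def by (intro prod.UNION_disjoint) (auto dest: take_inj)
  moreover have "(\<Prod>p\<in>{u} \<times> S. f p) = (\<Prod>j\<in>S. f (u, j))" for u and S :: "nat set"
    by (intro prod.reindex_bij_witness[of _ "Pair u" snd]) auto
  ultimately show ?thesis by simp
qed

lemma prod_list_map_nth: "prod_list (map r w) = (\<Prod>k<length w. r (w ! k))"
  by (induction w) (simp_all add: prod.lessThan_Suc_shift del: prod.lessThan_Suc)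

text \<open>Weierstrass' product inequality; it turns bounded products of factors at least 1 into
  summability of the excesses over 1.\<close>

lemma one_plus_sum_le_prod:
  fixes c :: "nat \<Rightarrow> real"
  assumes "\<And>i. i \<in> I \<Longrightarrow> 1 \<le> c i" "finite I"
  shows "1 + (\<Sum>i\<in>I. c i - 1) \<le> (\<Prod>i\<in>I. c i)"
  using assms(2,1)
proof (induction I)
  case (insert a I)
  have "0 \<le> (c a - 1) * ((\<Prod>i\<in>I. c i) - 1)"
    using insert by (intro mult_nonneg_nonneg) (auto intro!: prod_ge_1)
  then show ?case using insert by (simp add: algebra_simps)
qed simp

text \<open>Adding the quadratic Taylor bound for the exponential with nonnegative argument and the
  linear bound for the other gives half of the true quadratic term, enough to control second moments
  by exponential moments.\<close>

lemma exp_plus_exp_minus_ge: "2 + y\<^sup>2 / 2 \<le> exp y + exp (- y)" for y :: real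
proof -
  have *: "2 + y\<^sup>2 / 2 \<le> exp y + exp (- y)" if "0 \<le> y" for y :: real
    using exp_lower_Taylor_quadratic[OF that] exp_ge_add_one_self[of "- y"] by simp
  show ?thesis using *[of y] *[of "- y"] by (cases "0 \<le> y") auto
qed

section \<open>Laplace transforms of birth times and finiteness of truncated trees\<close>

context waiting_times
begin

text \<open>Taken in \<open>ennreal\<close> because for a positive argument the integral may be
  infinite; below the index \<open>K\<close> of the moment condition nothing prevents this.\<close>

definition mgf :: "real \<Rightarrow> nat \<Rightarrow> ennreal" where
  "mgf a j = (\<integral>\<^sup>+\<omega>. ennreal (exp (a * x [] j \<omega>)) \<partial>M)"

lemma nn_integral_exp_x: "(\<integral>\<^sup>+\<omega>. ennreal (exp (a * x u j \<omega>)) \<partial>M) = mgf a j"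
proof -
  have eq: "(\<integral>\<^sup>+\<omega>. ennreal (exp (a * x u j \<omega>)) \<partial>M) = (\<integral>\<^sup>+y. ennreal (exp (a * y)) \<partial>distr M borel (x u j))" for u
    by (subst nn_integral_distr) auto
  show ?thesis unfolding mgf_def eq[of u] eq[of "[]"] x_ident[of u j] ..
qed

lemma nn_integral_exp_sum_x:
  assumes "finite P"
  shows "(\<integral>\<^sup>+\<omega>. ennreal (exp (\<Sum>p\<in>P. a p * x (fst p) (snd p) \<omega>)) \<partial>M) = (\<Prod>p\<in>P. mgf (a p) (snd p))"
proof -
  have "(\<integral>\<^sup>+\<omega>. ennreal (exp (\<Sum>p\<in>P. a p * x (fst p) (snd p) \<omega>)) \<partial>M) =
      (\<integral>\<^sup>+\<omega>. (\<Prod>p\<in>P. ennreal (exp (a p * x (fst p) (snd p) \<omega>))) \<partial>M)"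
    using assms by (simp add: exp_sum prod_ennreal)
  also have "\<dots> = (\<Prod>p\<in>P. \<integral>\<^sup>+\<omega>. ennreal (exp (a p * x (fst p) (snd p) \<omega>)) \<partial>M)"
  proof (intro indep_vars_nn_integral assms)
    have "indep_vars (\<lambda>_. borel) (\<lambda>p \<omega>. (\<lambda>y. ennreal (exp (a p * y))) (x (fst p) (snd p) \<omega>)) UNIV"
      by (rule indep_vars_compose2[OF x_indep]) auto
    then show "indep_vars (\<lambda>_. borel) (\<lambda>p \<omega>. ennreal (exp (a p * x (fst p) (snd p) \<omega>))) P"
      by (rule indep_vars_subset) auto
  qed auto
  finally show ?thesis by (simp add: nn_integral_exp_x)
qed

text \<open>The Laplace transform at \<beta> of the age of a node at the birth of its child
  \<open>j\<close>. Transforms of birth times are products of such weights along a word, and the sum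
  over \<open>j\<close> is the ratio of the geometric series.\<close>

definition weight :: "real \<Rightarrow> nat \<Rightarrow> ennreal" where
  "weight \<beta> j = (\<Prod>i\<le>j. mgf (- \<beta>) i)"

abbreviation rx :: "'a \<Rightarrow> nat list \<Rightarrow> nat \<Rightarrow> real" where
  "rx \<omega> \<equiv> (\<lambda>u j. x u j \<omega>)"

lemma rbirth_anc: "rbirth (rx \<omega>) w = (\<Sum>p\<in>anc 0 w. x (fst p) (snd p) \<omega>)"
  by (simp add: sum_anc rbirth_def atLeast0LessThan)

lemma rbirth_measurable [measurable]: "(\<lambda>\<omega>. rbirth (rx \<omega>) w) \<in> borel_measurable M"
  unfolding rbirth_def by measurable

lemma kid_measurable [measurable]: "(\<lambda>\<omega>. kid (rx \<omega>) w n) \<in> borel_measurable M"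
  unfolding kid_def by measurable

lemma nn_integral_exp_rbirth:
  "(\<integral>\<^sup>+\<omega>. ennreal (exp (- \<beta> * rbirth (rx \<omega>) w)) \<partial>M) = prod_list (map (weight \<beta>) w)"
proof -
  have "(\<integral>\<^sup>+\<omega>. ennreal (exp (- \<beta> * rbirth (rx \<omega>) w)) \<partial>M) = (\<Prod>p\<in>anc 0 w. mgf (- \<beta>) (snd p))"
    unfolding rbirth_anc sum_distrib_left by (rule nn_integral_exp_sum_x) simp
  also have "\<dots> = prod_list (map (weight \<beta>) w)"
    by (simp add: prod_anc weight_def prod_list_map_nth atLeast0LessThan)
  finally show ?thesis .
qed

lemma weight_eq: "(\<integral>\<^sup>+\<omega>. ennreal (exp (- \<beta> * (\<Sum>i\<le>j. x [] i \<omega>))) \<partial>M) = weight \<beta> j"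
  using nn_integral_exp_rbirth[of \<beta> "[j]"] by (simp add: rbirth_def)

text \<open>Exponential Markov inequality: P(B(w) \<le> n) \<le> e^(\<beta>n) E e^(-\<beta> B(w)),
  and the right sides are summable over all words with letters in \<open>A\<close>. Both
  \<open>{..<m}\<close> and \<open>UNIV\<close> are needed for \<open>A\<close>.\<close>

lemma AE_finite_truncated_tree:
  assumes \<beta>: "0 < \<beta>" and less: "(\<Sum>j. if j \<in> A then weight \<beta> j else 0) < 1"
  shows "AE \<omega> in M. \<forall>t. finite {w \<in> lists A. rbirth (rx \<omega>) w \<le> t}"
proof -
  define r where "r j = (if j \<in> A then weight \<beta> j else 0)" for j
  obtain G where G: "G < \<infinity>" "\<And>F. finite F \<Longrightarrow> (\<Sum>w\<in>F. prod_list (map r w)) \<le> G"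
    using sum_prod_list_le[of r] less by (auto simp: r_def)
  have "AE \<omega> in M. finite {w. \<omega> \<in> (if w \<in> lists A then {\<omega>\<in>space M. rbirth (rx \<omega>) w \<le> real n} else {})}" for n :: nat
  proof (rule AE_finite_if_sum_emeasure_le)
    show "ennreal (exp (\<beta> * real n)) * G < \<infinity>" using G by (simp add: ennreal_mult_less_top)
    fix F :: "nat list set" assume F: "finite F"
    have "emeasure M (if w \<in> lists A then {\<omega>\<in>space M. rbirth (rx \<omega>) w \<le> real n} else {}) \<le>
        ennreal (exp (\<beta> * real n)) * prod_list (map r w)" for w
    proof (cases "w \<in> lists A")
      case True
      have "emeasure M {\<omega>\<in>space M. rbirth (rx \<omega>) w \<le> real n} =
          (\<integral>\<^sup>+\<omega>. indicator {\<omega>\<in>space M. rbirth (rx \<omega>) w \<le> real n} \<omega> \<partial>M)"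
        by (rule nn_integral_indicator[symmetric]) measurable
      also have "\<dots> \<le> (\<integral>\<^sup>+\<omega>. ennreal (exp (\<beta> * real n)) * ennreal (exp (- \<beta> * rbirth (rx \<omega>) w)) \<partial>M)"
      proof (intro nn_integral_mono)
        fix \<omega>
        have "1 \<le> exp (\<beta> * (real n - rbirth (rx \<omega>) w))" if "rbirth (rx \<omega>) w \<le> real n"
          using that \<beta> by simp
        then show "indicator {\<omega>\<in>space M. rbirth (rx \<omega>) w \<le> real n} \<omega> \<le>
            ennreal (exp (\<beta> * real n)) * ennreal (exp (- \<beta> * rbirth (rx \<omega>) w))"
          by (auto simp: indicator_def ennreal_mult[symmetric] exp_add[symmetric] algebra_simps)
      qed
      also have "\<dots> = ennreal (exp (\<beta> * real n)) * prod_list (map (weight \<beta>) w)"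
        by (simp add: nn_integral_cmult nn_integral_exp_rbirth[simplified])
      also have "map (weight \<beta>) w = map r w" using True by (auto simp: r_def)
      finally show ?thesis using True by simp
    qed simp
    then have "(\<Sum>w\<in>F. emeasure M (if w \<in> lists A then {\<omega>\<in>space M. rbirth (rx \<omega>) w \<le> real n} else {})) \<le>
        (\<Sum>w\<in>F. ennreal (exp (\<beta> * real n)) * prod_list (map r w))"
      by (intro sum_mono)
    also have "\<dots> \<le> ennreal (exp (\<beta> * real n)) * G"
      unfolding sum_distrib_left[symmetric] using G F by (intro mult_left_mono) auto
    finally show "(\<Sum>w\<in>F. emeasure M (if w \<in> lists A then {\<omega>\<in>space M. rbirth (rx \<omega>) w \<le> real n} else {})) \<le>
        ennreal (exp (\<beta> * real n)) * G" .
  qed auto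
  then have "AE \<omega> in M. \<forall>n::nat. finite {w. \<omega> \<in> (if w \<in> lists A then {\<omega>\<in>space M. rbirth (rx \<omega>) w \<le> real n} else {})}"
    by (subst AE_all_countable) auto
  then show ?thesis
    using AE_space
  proof eventually_elim
    case (elim \<omega>)
    show ?case
    proof
      fix t
      obtain n :: nat where "t \<le> real n" using real_arch_simple by blast
      then have "{w \<in> lists A. rbirth (rx \<omega>) w \<le> t} \<subseteq>
          {w. \<omega> \<in> (if w \<in> lists A then {\<omega>\<in>space M. rbirth (rx \<omega>) w \<le> real n} else {})}"
        using elim(2) by auto
      then show "finite {w \<in> lists A. rbirth (rx \<omega>) w \<le> t}"
        using elim(1) finite_subset by blast
    qed
  qed
qed

lemma weight_eq_real: "weight \<beta> j = ennreal (\<Prod>i\<le>j. expectation (\<lambda>\<omega>. exp (- \<beta> * x [] i \<omega>)))" if "0 \<le> \<beta>"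
proof -
  have "mgf (- \<beta>) i = ennreal (expectation (\<lambda>\<omega>. exp (- \<beta> * x [] i \<omega>)))" for i
    unfolding mgf_def using that x_nonneg
    by (intro nn_integral_eq_integral integrable_const_bound[where B = 1]) auto
  then show ?thesis by (simp add: weight_def prod_ennreal)
qed

text \<open>By dominated convergence E e^(-nX) tends to P(X = 0) as n grows, and finite sums of
  finite products follow. Hence some large n makes the total weight of the first \<open>m\<close>
  children less than 1.\<close>

lemma AE_finite_truncated_trees:
  assumes A3: "(\<Sum>j<m. \<Prod>i\<le>j. \<P>(\<omega> in M. x [] i \<omega> = 0)) < 1"
  shows "AE \<omega> in M. \<forall>t. finite {w \<in> lists {..<m}. rbirth (rx \<omega>) w \<le> t}"
proof -
  let ?E = "\<lambda>n i. expectation (\<lambda>\<omega>. exp (- real n * x [] i \<omega>))"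
  have lim: "(\<lambda>n. ?E n i) \<longlonglongrightarrow> \<P>(\<omega> in M. x [] i \<omega> = 0)" for i
  proof -
    have "(\<lambda>n. ?E n i) \<longlonglongrightarrow> expectation (indicator {\<omega>\<in>space M. x [] i \<omega> = 0})"
    proof (rule integral_dominated_convergence[where w = "\<lambda>_. 1"])
      show "AE \<omega> in M. (\<lambda>n. exp (- real n * x [] i \<omega>)) \<longlonglongrightarrow> indicator {\<omega>\<in>space M. x [] i \<omega> = 0} \<omega>"
      proof (rule AE_I2)
        fix \<omega> assume \<omega>: "\<omega> \<in> space M"
        show "(\<lambda>n. exp (- real n * x [] i \<omega>)) \<longlonglongrightarrow> indicator {\<omega>\<in>space M. x [] i \<omega> = 0} \<omega>"
        proof (cases "x [] i \<omega> = 0")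
          case True
          then show ?thesis using \<omega> by simp
        next
          case False
          then have "0 < x [] i \<omega>" using x_nonneg[of "[]" i \<omega>] by simp
          then have "(\<lambda>n. exp (- x [] i \<omega>) ^ n) \<longlonglongrightarrow> 0"
            by (intro LIMSEQ_power_zero) simp
          moreover have "exp (- real n * x [] i \<omega>) = exp (- x [] i \<omega>) ^ n" for n
            by (simp add: exp_of_nat_mult[symmetric])
          ultimately show ?thesis using False by simp
        qed
      qed
    qed (use x_nonneg in auto)
    then show ?thesis by simp
  qed
  have "(\<lambda>n. \<Sum>j<m. \<Prod>i\<le>j. ?E n i) \<longlonglongrightarrow> (\<Sum>j<m. \<Prod>i\<le>j. \<P>(\<omega> in M. x [] i \<omega> = 0))"
    by (intro tendsto_sum tendsto_prod lim)
  then have "\<forall>\<^sub>F n in sequentially. (\<Sum>j<m. \<Prod>i\<le>j. ?E n i) < 1"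
    using A3 by (rule order_tendstoD)
  then have "\<forall>\<^sub>F n in sequentially. (\<Sum>j<m. \<Prod>i\<le>j. ?E n i) < 1 \<and> 0 < n"
    using eventually_gt_at_top by (rule eventually_conj)
  then obtain n where n: "(\<Sum>j<m. \<Prod>i\<le>j. ?E n i) < 1" "0 < n"
    by (auto simp: eventually_sequentially)
  have "(\<Sum>j. if j \<in> {..<m} then weight (real n) j else 0) = (\<Sum>j<m. weight (real n) j)"
    by (subst suminf_finite[of "{..<m}"]) (auto intro!: sum.cong)
  also have "\<dots> = ennreal (\<Sum>j<m. \<Prod>i\<le>j. ?E n i)"
    by (subst sum_ennreal[symmetric]) (auto simp: weight_eq_real intro!: prod_nonneg)
  also have "\<dots> < 1" using n by (simp add: ennreal_less_one_iff)
  finally show ?thesis using n by (intro AE_finite_truncated_tree[of "real n"]) auto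
qed

lemma AE_no_persistent_hub:
  assumes A3: "\<And>m. (\<Sum>j<m. \<Prod>i\<le>j. \<P>(\<omega> in M. x [] i \<omega> = 0)) < 1"
    and div: "\<And>u v. u \<noteq> v \<Longrightarrow> AE \<omega> in M. \<not> summable (\<lambda>j. x u j \<omega> - x v j \<omega>)"
  shows "AE \<omega> in M. \<not> has_persistent_hub
    (\<lambda>n. cmj_tree (\<lambda>u j. ennreal (x u j \<omega>)) (cmj_tau (\<lambda>u j. ennreal (x u j \<omega>)) n))"
proof -
  have "AE \<omega> in M. u \<noteq> v \<longrightarrow> (\<forall>C. \<exists>n. C < (\<Sum>j<n. x u j \<omega> - x v j \<omega>))" for u v
  proof (cases "u = v")
    case False
    from AE_unbounded_above_if_not_summable[OF x_diff_indep[OF False] x_diff_symmetric div[OF False]]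
    show ?thesis by simp
  qed simp
  then have "AE \<omega> in M. \<forall>u v. u \<noteq> v \<longrightarrow> (\<forall>C. \<exists>n. C < (\<Sum>j<n. x u j \<omega> - x v j \<omega>))"
    by (simp add: AE_all_countable)
  moreover have "AE \<omega> in M. \<forall>m t. finite {w \<in> lists {..<m}. rbirth (rx \<omega>) w \<le> t}"
    using AE_finite_truncated_trees[OF A3] by (subst AE_all_countable) auto
  ultimately show ?thesis
  proof eventually_elim
    case (elim \<omega>)
    show ?case
      by (rule no_persistent_hub_if[of "rx \<omega>"]) (use elim x_nonneg in auto)
  qed
qed


section \<open>Eventual comparability of two nodes under the moment conditions\<close>

definition factor :: "real \<Rightarrow> nat \<Rightarrow> ennreal" where
  "factor \<alpha> i = mgf \<alpha> i * mgf (- \<alpha>) i"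

lemma nn_integral_exp_diff:
  assumes "u \<noteq> v"
  shows "(\<integral>\<^sup>+\<omega>. ennreal (exp (\<alpha> * (x u i \<omega> - x v i \<omega>))) \<partial>M) = factor \<alpha> i"
proof -
  have "(\<integral>\<^sup>+\<omega>. ennreal (exp (\<Sum>p\<in>{(u, i), (v, i)}. (if fst p = u then \<alpha> else - \<alpha>) * x (fst p) (snd p) \<omega>)) \<partial>M) =
      (\<Prod>p\<in>{(u, i), (v, i)}. mgf (if fst p = u then \<alpha> else - \<alpha>) (snd p))"
    by (rule nn_integral_exp_sum_x) simp
  then show ?thesis using assms by (auto simp: factor_def algebra_simps)
qed

text \<open>The difference and its negative have the same exponential moment, so twice this moment
  is the mean of e^y + e^(-y) and dominates a second moment: E(X - X')^2 \<le> 4/\<alpha>^2 times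
  the excess of the factor over 1.\<close>

lemma factor_ge:
  assumes uv: "u \<noteq> v"
  shows "2 + ennreal (\<alpha>\<^sup>2 / 2) * (\<integral>\<^sup>+\<omega>. ennreal ((x u i \<omega> - x v i \<omega>)\<^sup>2) \<partial>M) \<le> 2 * factor \<alpha> i"
proof -
  have "2 + ennreal (\<alpha>\<^sup>2 / 2) * (\<integral>\<^sup>+\<omega>. ennreal ((x u i \<omega> - x v i \<omega>)\<^sup>2) \<partial>M) =
      (\<integral>\<^sup>+\<omega>. 2 + ennreal (\<alpha>\<^sup>2 / 2) * ennreal ((x u i \<omega> - x v i \<omega>)\<^sup>2) \<partial>M)"
    by (simp add: nn_integral_add nn_integral_cmult emeasure_space_1)
  also have "\<dots> \<le> (\<integral>\<^sup>+\<omega>. ennreal (exp (\<alpha> * (x u i \<omega> - x v i \<omega>))) + ennreal (exp (\<alpha> * (x v i \<omega> - x u i \<omega>))) \<partial>M)"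
  proof (intro nn_integral_mono)
    fix \<omega>
    have "2 + \<alpha>\<^sup>2 / 2 * (x u i \<omega> - x v i \<omega>)\<^sup>2 \<le>
        exp (\<alpha> * (x u i \<omega> - x v i \<omega>)) + exp (\<alpha> * (x v i \<omega> - x u i \<omega>))"
      using exp_plus_exp_minus_ge[of "\<alpha> * (x u i \<omega> - x v i \<omega>)"]
      by (simp add: power_mult_distrib flip: mult_minus_right)
    from ennreal_leI[OF this]
    show "2 + ennreal (\<alpha>\<^sup>2 / 2) * ennreal ((x u i \<omega> - x v i \<omega>)\<^sup>2) \<le>
        ennreal (exp (\<alpha> * (x u i \<omega> - x v i \<omega>))) + ennreal (exp (\<alpha> * (x v i \<omega> - x u i \<omega>)))"
      by (simp add: ennreal_mult del: times_divide_eq_left)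
  qed
  also have "\<dots> = factor \<alpha> i + factor \<alpha> i"
    using uv by (simp add: nn_integral_add nn_integral_exp_diff)
  finally show ?thesis by (simp add: mult_2)
qed

lemma factor_ge_1: "1 \<le> factor \<alpha> i"
proof -
  have "2 * (1 :: ennreal) \<le> 2 * factor \<alpha> i"
    by (rule order_trans[OF _ factor_ge[of "[0]" "[]" \<alpha> i]]) simp_all
  then show ?thesis
    by (subst (asm) ennreal_mult_le_mult_iff) auto
qed

context
  fixes \<alpha> :: real and K :: nat
  assumes \<alpha>: "0 < \<alpha>"
    and weight1: "(\<Sum>j. weight \<alpha> j) < 1"
    and factors: "(SUP n. \<Prod>i\<in>{K..<n}. factor \<alpha> i) < \<infinity>"
begin

abbreviation "bound \<equiv> (SUP n. \<Prod>i\<in>{K..<n}. factor \<alpha> i)"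

text \<open>All factors are at least 1, so products that start later are smaller.\<close>

lemma prod_factor_le: "K \<le> a \<Longrightarrow> (\<Prod>i\<in>{a..<n}. factor \<alpha> i) \<le> bound"
proof -
  assume a: "K \<le> a"
  have ge_1: "1 \<le> (\<Prod>i\<in>I. factor \<alpha> i)" for I
  proof (induction I rule: infinite_finite_induct)
    case (insert i I)
    then show ?case using mult_mono[OF factor_ge_1 insert.IH] by simp
  qed auto
  have "(\<Prod>i\<in>{a..<n}. factor \<alpha> i) \<le> (\<Prod>i\<in>{K..<n}. factor \<alpha> i)"
  proof (cases "a \<le> n")
    case True
    then have "(\<Prod>i\<in>{K..<n}. factor \<alpha> i) = (\<Prod>i\<in>{K..<a}. factor \<alpha> i) * (\<Prod>i\<in>{a..<n}. factor \<alpha> i)"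
      using a by (simp add: prod.atLeastLessThan_concat)
    then show ?thesis using mult_right_mono[OF ge_1[of "{K..<a}"]] by simp
  qed (use ge_1 in auto)
  also have "\<dots> \<le> bound" by (rule SUP_upper) simp
  finally show ?thesis .
qed

lemma factor_finite: "K \<le> i \<Longrightarrow> factor \<alpha> i < \<infinity>"
  using prod_factor_le[of i "Suc i"] factors by (simp add: le_less_trans)

text \<open>Bounded products make the excesses of the factors over 1 summable, and these dominate
  the second moments up to the constant 4/\<alpha>^2.\<close>

lemma summable_second_moments:
  assumes uv: "u \<noteq> v" and N: "K \<le> N"
  shows "integrable M (\<lambda>\<omega>. (x u (N + i) \<omega> - x v (N + i) \<omega>)\<^sup>2)"
    and "summable (\<lambda>i. expectation (\<lambda>\<omega>. (x u (N + i) \<omega> - x v (N + i) \<omega>)\<^sup>2))"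
proof -
  define c where "c i = enn2real (factor \<alpha> (N + i))" for i
  have c: "factor \<alpha> (N + i) = ennreal (c i)" for i
    using factor_finite[of "N + i"] N by (simp add: c_def)
  have c1: "1 \<le> c i" for i using factor_ge_1[of \<alpha> "N + i"] by (simp add: c)
  let ?V = "\<lambda>i. \<integral>\<^sup>+\<omega>. ennreal ((x u (N + i) \<omega> - x v (N + i) \<omega>)\<^sup>2) \<partial>M"
  have V: "ennreal (\<alpha>\<^sup>2 / 2) * ?V i \<le> ennreal (2 * (c i - 1))" for i
  proof -
    have "2 + ennreal (\<alpha>\<^sup>2 / 2) * ?V i \<le> ennreal (2 * c i)"
      using factor_ge[OF uv, of \<alpha> "N + i"] c1[of i] by (simp add: c ennreal_mult)
    also have "ennreal (2 * c i) = 2 + ennreal (2 * (c i - 1))"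
      using c1[of i] by (simp add: ennreal_plus[symmetric] algebra_simps del: ennreal_plus flip: ennreal_numeral)
    finally show ?thesis by (simp add: ennreal_add_left_cancel_le)
  qed
  have int: "integrable M (\<lambda>\<omega>. (x u (N + i) \<omega> - x v (N + i) \<omega>)\<^sup>2)" for i
  proof (rule integrableI_bounded)
    have "ennreal (\<alpha>\<^sup>2 / 2) * ?V i < \<infinity>" using le_less_trans[OF V] by simp
    then have "?V i < \<infinity>" using \<alpha> by (auto simp: ennreal_mult_less_top)
    then show "(\<integral>\<^sup>+\<omega>. ennreal (norm ((x u (N + i) \<omega> - x v (N + i) \<omega>)\<^sup>2)) \<partial>M) < \<infinity>" by simp
  qed auto
  then show "integrable M (\<lambda>\<omega>. (x u (N + i) \<omega> - x v (N + i) \<omega>)\<^sup>2)" .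
  let ?v = "\<lambda>i. expectation (\<lambda>\<omega>. (x u (N + i) \<omega> - x v (N + i) \<omega>)\<^sup>2)"
  have v: "\<alpha>\<^sup>2 / 2 * ?v i \<le> 2 * (c i - 1)" for i
    using V[of i] c1[of i] by (subst (asm) nn_integral_eq_integral[OF int]) (auto simp: ennreal_mult[symmetric])
  have "(\<Sum>i\<le>n. c i - 1) \<le> enn2real bound" for n
  proof -
    have "1 + (\<Sum>i\<le>n. c i - 1) \<le> (\<Prod>i\<le>n. c i)"
      using c1 by (intro one_plus_sum_le_prod) auto
    moreover have "ennreal (\<Prod>i\<le>n. c i) \<le> bound"
    proof -
      have "ennreal (\<Prod>i\<le>n. c i) = (\<Prod>i\<le>n. factor \<alpha> (N + i))"
        using c1 by (simp add: c prod_ennreal order_trans[OF zero_le_one])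
      also have "\<dots> = (\<Prod>i\<in>{N..<N + Suc n}. factor \<alpha> i)"
        using prod.shift_bounds_nat_ivl[of "factor \<alpha>" 0 N "Suc n"]
        by (simp add: lessThan_Suc_atMost[symmetric] atLeast0LessThan add.commute del: prod.lessThan_Suc prod.op_ivl_Suc)
      also have "\<dots> \<le> bound" by (rule prod_factor_le[OF N])
      finally show ?thesis .
    qed
    then have "(\<Prod>i\<le>n. c i) \<le> enn2real bound"
      using factors c1 by (cases bound) (auto simp: prod_nonneg order_trans[OF zero_le_one])
    ultimately show ?thesis by simp
  qed
  then have "summable (\<lambda>i. c i - 1)"
    using c1 by (intro bounded_imp_summable) auto
  then have "summable (\<lambda>i. 4 / \<alpha>\<^sup>2 * (c i - 1))" by (rule summable_mult)
  then show "summable ?v"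
  proof (rule summable_comparison_test'[where N = 0])
    fix i
    show "norm (?v i) \<le> 4 / \<alpha>\<^sup>2 * (c i - 1)"
      using v[of i] \<alpha> by (simp add: field_simps)
  qed
qed

lemma AE_eventually_comparable:
  "AE \<omega> in M. (\<forall>\<^sub>F n in sequentially. kid (rx \<omega>) u n \<le> kid (rx \<omega>) v n) \<or>
               (\<forall>\<^sub>F n in sequentially. kid (rx \<omega>) v n \<le> kid (rx \<omega>) u n)"
proof (cases "u = v")
  case uv: False
  \<comment> \<open>Every letter of \<open>u\<close> and \<open>v\<close> is smaller than
    \<open>N\<close>, so waiting times with index \<open>N\<close> or more enter neither birth time,
    whatever the position of the two nodes; \<open>K\<close> is added for the finiteness of the
    factors.\<close>
  define N where "N = K + Suc (sum_list u + sum_list v)"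
  have KN: "K \<le> N" by (simp add: N_def)
  have Nu: "p \<in> anc 0 w \<Longrightarrow> snd p < N" if "w = u \<or> w = v" for w p
  proof -
    assume "p \<in> anc 0 w"
    then obtain k where k: "k < length w" "snd p \<le> w ! k" by (auto simp: anc_def)
    then have "w ! k \<le> sum_list w" by (intro member_le_sum_list) auto
    then show "snd p < N" using k that by (auto simp: N_def)
  qed
  define B where "B w z = (\<Sum>p\<in>anc 0 w. z p) + (\<Sum>j<N. z (w, j))" for w and z :: "nat list \<times> nat \<Rightarrow> real"
  define g where "g i z = (case i of 0 \<Rightarrow> B u z - B v z | Suc i \<Rightarrow> z (u, N + i) - z (v, N + i))"
    for i and z :: "nat list \<times> nat \<Rightarrow> real"
  define D where "D i \<omega> = g i (\<lambda>p. x (fst p) (snd p) \<omega>)" for i \<omega>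
  have D0: "D 0 \<omega> = kid (rx \<omega>) u N - kid (rx \<omega>) v N" for \<omega>
    by (simp add: D_def g_def B_def kid_def rbirth_anc)
  have DS: "D (Suc i) \<omega> = x u (N + i) \<omega> - x v (N + i) \<omega>" for i \<omega>
    by (simp add: D_def g_def)
  have sumD: "(\<Sum>i<Suc n. D i \<omega>) = kid (rx \<omega>) u (n + N) - kid (rx \<omega>) v (n + N)" for n \<omega>
    by (induction n) (simp_all add: D0 DS kid_def add.commute)
  have indep: "indep_vars (\<lambda>_. borel) D UNIV"
    unfolding D_def
  \<comment> \<open>The start may use everything with index below \<open>N\<close>; each later
    increment owns one index.\<close>
  proof (rule indep_vars_disjoint_blocks[where K = "\<lambda>i. case i of 0 \<Rightarrow> {p. snd p < N} | Suc i \<Rightarrow> {p. snd p = N + i}"])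
    show "disjoint_family (\<lambda>i. case i of 0 \<Rightarrow> {p. snd p < N} | Suc i \<Rightarrow> {p. snd p = N + i})"
      by (auto simp: disjoint_family_on_def split: nat.splits)
    show "g i \<in> borel_measurable (PiM UNIV (\<lambda>_. borel))" for i
      unfolding g_def B_def by (cases i) (auto intro!: borel_measurable_diff borel_measurable_add borel_measurable_sum)
    have "B w (\<lambda>p. if snd p < N then z p else 0) = B w z" if "w = u \<or> w = v" for w z
      unfolding B_def using Nu[OF that] by (intro arg_cong2[where f = "(+)"] sum.cong) auto
    then show "g i (\<lambda>p. if p \<in> (case i of 0 \<Rightarrow> {p. snd p < N} | Suc i \<Rightarrow> {p. snd p = N + i}) then z p else 0) = g i z" for i z
      by (cases i) (auto simp: g_def)
  qed
  have sym: "distr M borel (D i) = distr M borel (\<lambda>\<omega>. - D i \<omega>)" if "1 \<le> i" for i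
    using that x_diff_symmetric[of u _ v] by (cases i) (simp_all add: DS[abs_def])
  have "AE \<omega> in M. summable (\<lambda>i. x u (N + i) \<omega> - x v (N + i) \<omega>)"
  proof (rule AE_summable_symmetric)
    show "indep_vars (\<lambda>_. borel) (\<lambda>i \<omega>. x u (N + i) \<omega> - x v (N + i) \<omega>) UNIV"
      using indep_vars_inj_reindex[OF x_diff_indep[OF uv], of "\<lambda>i. N + i"] by (simp add: inj_def)
  qed (rule x_diff_symmetric summable_second_moments[OF uv KN])+
  moreover have "AE \<omega> in M. (\<lambda>n. \<Sum>i<n. D i \<omega>) \<longlonglongrightarrow> 0 \<longrightarrow> (\<forall>\<^sub>F n in sequentially. (\<Sum>i<n. D i \<omega>) = 0)"
    by (rule AE_tendsto_0_imp_eventually_0[OF indep sym])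
  ultimately show ?thesis
  proof eventually_elim
    case (elim \<omega>)
    then have "summable (\<lambda>i. D i \<omega>)"
      by (subst summable_Suc_iff[symmetric]) (simp add: DS)
    then obtain w where w: "(\<lambda>n. \<Sum>i<n. D i \<omega>) \<longlonglongrightarrow> w"
      by (auto simp: summable_def sums_def)
    have "(\<forall>\<^sub>F n in sequentially. (\<Sum>i<n. D i \<omega>) \<le> 0) \<or> (\<forall>\<^sub>F n in sequentially. 0 \<le> (\<Sum>i<n. D i \<omega>))"
    proof (cases w "0 :: real" rule: linorder_cases)
      case less
      from order_tendstoD(2)[OF w less] have "\<forall>\<^sub>F n in sequentially. (\<Sum>i<n. D i \<omega>) \<le> 0"
        by eventually_elim simp
      then show ?thesis ..
    next
      case greater
      from order_tendstoD(1)[OF w greater] have "\<forall>\<^sub>F n in sequentially. 0 \<le> (\<Sum>i<n. D i \<omega>)"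
        by eventually_elim simp
      then show ?thesis ..
    \<comment> \<open>Only a zero limit leaves the sign undecided, and then the walk is eventually
      equal to 0.\<close>
    next
      case equal
      with elim w have "\<forall>\<^sub>F n in sequentially. (\<Sum>i<n. D i \<omega>) = 0" by simp
      then have "\<forall>\<^sub>F n in sequentially. (\<Sum>i<n. D i \<omega>) \<le> 0" by eventually_elim simp
      then show ?thesis ..
    qed
    then have "(\<forall>\<^sub>F n in sequentially. (\<Sum>i<Suc n. D i \<omega>) \<le> 0) \<or> (\<forall>\<^sub>F n in sequentially. 0 \<le> (\<Sum>i<Suc n. D i \<omega>))"
      unfolding eventually_sequentially_Suc[of "\<lambda>n. (\<Sum>i<n. D i \<omega>) \<le> 0"] eventually_sequentially_Suc[of "\<lambda>n. 0 \<le> (\<Sum>i<n. D i \<omega>)"] .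
    then have "(\<forall>\<^sub>F n in sequentially. kid (rx \<omega>) u (n + N) \<le> kid (rx \<omega>) v (n + N)) \<or>
               (\<forall>\<^sub>F n in sequentially. kid (rx \<omega>) v (n + N) \<le> kid (rx \<omega>) u (n + N))"
      unfolding sumD by simp
    then show ?case
      unfolding eventually_sequentially_seg[of "\<lambda>n. kid (rx \<omega>) u n \<le> kid (rx \<omega>) v n"]
        eventually_sequentially_seg[of "\<lambda>n. kid (rx \<omega>) v n \<le> kid (rx \<omega>) u n"] .
  qed
qed simp

section \<open>Finitely many nodes overtake the root\<close>

lemma emeasure_exceeds_le:
  assumes indep: "indep_vars (\<lambda>_. borel) D UNIV"
    and sym: "\<And>i. 1 \<le> i \<Longrightarrow> distr M borel (D i) = distr M borel (\<lambda>\<omega>. - D i \<omega>)"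
    and C: "\<And>n. (\<integral>\<^sup>+\<omega>. ennreal (exp (\<alpha> * (\<Sum>i<Suc n. D i \<omega>))) \<partial>M) \<le> C"
  shows "emeasure M {\<omega>\<in>space M. \<exists>n. 0 < (\<Sum>i<Suc n. D i \<omega>)} \<le> 2 * C"
proof -
  have [measurable]: "D i \<in> borel_measurable M" for i
    using indep by (auto simp: indep_vars_def)
  let ?A = "\<lambda>N. {\<omega>\<in>space M. \<exists>n\<in>{1..Suc N}. 0 < (\<Sum>i<n. D i \<omega>)}"
  have "emeasure M (?A N) \<le> 2 * C" for N
  proof -
    \<comment> \<open>The maximal inequality replaces the whole path by its value at the horizon, to
      which the exponential Markov inequality applies; the bound \<open>2 * C\<close> does not
      depend on the horizon. The window starts at 1 because \<open>D 0\<close> is not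
      symmetric.\<close>
    have "prob (?A N) \<le> 2 * \<P>(\<omega> in M. 0 < (\<Sum>i<Suc N. D i \<omega>))"
      using levy_inequality[OF indep sym, of 1 "Suc N" 0] by simp
    then have "emeasure M (?A N) \<le> 2 * emeasure M {\<omega>\<in>space M. 0 < (\<Sum>i<Suc N. D i \<omega>)}"
      unfolding emeasure_eq_measure by (subst ennreal_numeral[symmetric], subst ennreal_mult[symmetric]) auto
    also have "emeasure M {\<omega>\<in>space M. 0 < (\<Sum>i<Suc N. D i \<omega>)} =
        (\<integral>\<^sup>+\<omega>. indicator {\<omega>\<in>space M. 0 < (\<Sum>i<Suc N. D i \<omega>)} \<omega> \<partial>M)"
      by (rule nn_integral_indicator[symmetric]) measurable
    also have "\<dots> \<le> (\<integral>\<^sup>+\<omega>. ennreal (exp (\<alpha> * (\<Sum>i<Suc N. D i \<omega>))) \<partial>M)"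
      using \<alpha> by (intro nn_integral_mono) (auto simp: indicator_def simp del: sum.lessThan_Suc)
    also have "\<dots> \<le> C" by (rule C)
    finally show ?thesis by (simp add: mult_left_mono)
  qed
  moreover have "(\<lambda>N. emeasure M (?A N)) \<longlonglongrightarrow> emeasure M (\<Union>N. ?A N)"
    by (intro Lim_emeasure_incseq) (auto simp: incseq_def intro: order_trans)
  ultimately have "emeasure M (\<Union>N. ?A N) \<le> 2 * C"
    by (intro LIMSEQ_le_const2) auto
  moreover have "{\<omega>\<in>space M. \<exists>n. 0 < (\<Sum>i<Suc n. D i \<omega>)} \<subseteq> (\<Union>N. ?A N)"
  proof safe
    fix \<omega> n assume "\<omega> \<in> space M" "0 < (\<Sum>i<Suc n. D i \<omega>)"
    then have "\<omega> \<in> ?A n" by (auto intro!: bexI[of _ "Suc n"])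
    then show "\<omega> \<in> (\<Union>N. ?A N)" by blast
  qed
  then have "emeasure M {\<omega>\<in>space M. \<exists>n. 0 < (\<Sum>i<Suc n. D i \<omega>)} \<le> emeasure M (\<Union>N. ?A N)"
    by (rule emeasure_mono) measurable
  ultimately show ?thesis by (blast intro: order_trans)
qed

text \<open>On the event that the \<open>K\<close>-th child of the root is born by time \<open>g\<close>, a node \<open>j # w\<close> overtaking the
  root makes a walk with symmetric increments, started at \<open>g\<close> minus a time that involves neither the root
  nor the later increments, positive.\<close>

lemma emeasure_overtakes_root_le:
  fixes g :: nat
  defines "k \<equiv> \<lambda>j. max (Suc j) K"
  shows "emeasure M {\<omega>\<in>space M. kid (rx \<omega>) [] K \<le> real g \<and> (\<exists>n\<ge>K. kid (rx \<omega>) (j # w) n < kid (rx \<omega>) [] n)} \<le>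
    2 * (ennreal (exp (\<alpha> * real g)) * bound * ((\<Prod>i<k j. mgf (- \<alpha>) i) * prod_list (map (weight \<alpha>) w)))"
proof -
  define u where "u = j # w"
  \<comment> \<open>Beyond \<open>Suc j\<close> no waiting time of the root enters the birth time of
    \<open>u\<close>, and beyond \<open>K\<close> the products of factors are bounded.\<close>
  define k' where "k' = k j"
  have k': "K \<le> k'" "Suc j \<le> k'" by (auto simp: k'_def k_def)
  have anc: "fst p \<noteq> []" "fst p \<noteq> u" if "p \<in> anc 1 u" for p
    using that by (auto simp: anc_def u_def)
  define B where "B z = (\<Sum>p\<in>anc 1 u. z p) + (\<Sum>i<k'. z (u, i))" for z :: "nat list \<times> nat \<Rightarrow> real"
  define f where "f i z = (case i of 0 \<Rightarrow> real g - B z | Suc i \<Rightarrow> z ([], k' + i) - z (u, k' + i))"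
    for i and z :: "nat list \<times> nat \<Rightarrow> real"
  define D where "D i \<omega> = f i (\<lambda>p. x (fst p) (snd p) \<omega>)" for i \<omega>
  have DS: "D (Suc i) \<omega> = x [] (k' + i) \<omega> - x u (k' + i) \<omega>" for i \<omega>
    by (simp add: D_def f_def)
  define B' where "B' \<omega> = (\<Sum>p\<in>anc 1 u. x (fst p) (snd p) \<omega>)" for \<omega>
  have sumD: "(\<Sum>i<Suc n. D i \<omega>) =
      real g - B' \<omega> - (\<Sum>i<k' + n. x u i \<omega>) + (\<Sum>i\<in>{k'..<k' + n}. x [] i \<omega>)" for n \<omega>
    by (induction n) (simp_all add: DS D_def f_def B_def B'_def)
  have birth_u: "rbirth (rx \<omega>) u = (\<Sum>i<Suc j. x [] i \<omega>) + B' \<omega>" for \<omega>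
    unfolding rbirth_anc B'_def sum_anc u_def
    by (simp add: sum.atLeast_Suc_lessThan[of 0] lessThan_Suc_atMost)
  \<comment> \<open>The start contains only waiting times of proper ancestors other than the root
    and of \<open>u\<close> below \<open>k'\<close>; the root's share has been replaced by
    \<open>real g\<close>.\<close>
  let ?K = "\<lambda>i. case i of 0 \<Rightarrow> {p. fst p \<noteq> [] \<and> (fst p = u \<longrightarrow> snd p < k')} | Suc i \<Rightarrow> {([], k' + i), (u, k' + i)}"
  have indep: "indep_vars (\<lambda>_. borel) D UNIV"
    unfolding D_def
  proof (rule indep_vars_disjoint_blocks[where K = ?K])
    show "disjoint_family ?K"
      by (auto simp: disjoint_family_on_def u_def split: nat.splits)
    show "f i \<in> borel_measurable (PiM UNIV (\<lambda>_. borel))" for i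
      unfolding f_def B_def by (cases i) (auto intro!: borel_measurable_diff borel_measurable_add borel_measurable_sum)
    have "B (\<lambda>p. if p \<in> ?K 0 then z p else 0) = B z" for z
      unfolding B_def using anc by (intro arg_cong2[where f = "(+)"] sum.cong) (auto simp: u_def)
    then show "f i (\<lambda>p. if p \<in> ?K i then z p else 0) = f i z" for i z
      by (cases i) (auto simp: f_def)
  qed
  have sym: "distr M borel (D i) = distr M borel (\<lambda>\<omega>. - D i \<omega>)" if "1 \<le> i" for i
    using that x_diff_symmetric[of "[]" _ u] by (cases i) (simp_all add: DS[abs_def])
  let ?C = "ennreal (exp (\<alpha> * real g)) * bound * ((\<Prod>i<k'. mgf (- \<alpha>) i) * prod_list (map (weight \<alpha>) w))"
  have C: "(\<integral>\<^sup>+\<omega>. ennreal (exp (\<alpha> * (\<Sum>i<Suc n. D i \<omega>))) \<partial>M) \<le> ?C" for n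
  proof -
    \<comment> \<open>Proper ancestors without the root, \<open>u\<close> itself, and the root. From
      index \<open>k'\<close> on the transforms of \<open>u\<close> and of the root pair up to
      \<open>factor\<close>; the others remain as decaying weights.\<close>
    define P1 P2 P3 where "P1 = anc 1 u" and "P2 = {u} \<times> {..<k' + n}" and "P3 = {[] :: nat list} \<times> {k'..<k' + n}"
    have fin: "finite P1" "finite P2" "finite P3" by (auto simp: P1_def P2_def P3_def)
    have "p \<notin> P2" "p \<notin> P3" if "p \<in> P1" for p
      using anc[of p] that by (auto simp: P1_def P2_def P3_def)
    moreover have "P2 \<inter> P3 = {}" by (auto simp: P2_def P3_def u_def)
    ultimately have disj: "P1 \<inter> P2 = {}" "(P1 \<union> P2) \<inter> P3 = {}" by blast+
    define a where "a p = (if fst p = [] then \<alpha> else - \<alpha>)" for p :: "nat list \<times> nat"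
    have a1: "p \<in> P1 \<Longrightarrow> a p = - \<alpha>" for p using anc by (auto simp: a_def P1_def)
    have "\<alpha> * (\<Sum>i<Suc n. D i \<omega>) = \<alpha> * real g + (\<Sum>p\<in>P1 \<union> P2 \<union> P3. a p * x (fst p) (snd p) \<omega>)" for \<omega>
    proof -
      have "(\<Sum>p\<in>P1. a p * x (fst p) (snd p) \<omega>) = - \<alpha> * B' \<omega>"
        using a1 unfolding B'_def sum_distrib_left by (intro sum.cong) (auto simp: P1_def)
      moreover have "(\<Sum>p\<in>P2. a p * x (fst p) (snd p) \<omega>) = - \<alpha> * (\<Sum>i<k' + n. x u i \<omega>)"
        unfolding sum_distrib_left P2_def
        by (intro sum.reindex_bij_witness[of _ "Pair u" snd]) (auto simp: a_def u_def)
      moreover have "(\<Sum>p\<in>P3. a p * x (fst p) (snd p) \<omega>) = \<alpha> * (\<Sum>i\<in>{k'..<k' + n}. x [] i \<omega>)"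
        unfolding sum_distrib_left P3_def
        by (intro sum.reindex_bij_witness[of _ "Pair []" snd]) (auto simp: a_def)
      ultimately show ?thesis
        unfolding sumD using fin disj by (simp add: sum.union_disjoint algebra_simps)
    qed
    then have "(\<integral>\<^sup>+\<omega>. ennreal (exp (\<alpha> * (\<Sum>i<Suc n. D i \<omega>))) \<partial>M) =
        (\<integral>\<^sup>+\<omega>. ennreal (exp (\<alpha> * real g)) * ennreal (exp (\<Sum>p\<in>P1 \<union> P2 \<union> P3. a p * x (fst p) (snd p) \<omega>)) \<partial>M)"
      by (simp only: exp_add ennreal_mult exp_ge_zero)
    also have "\<dots> = ennreal (exp (\<alpha> * real g)) * (\<Prod>p\<in>P1 \<union> P2 \<union> P3. mgf (a p) (snd p))"
      using fin by (subst nn_integral_cmult) (auto simp: nn_integral_exp_sum_x)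
    also have "(\<Prod>p\<in>P1 \<union> P2 \<union> P3. mgf (a p) (snd p)) =
        (\<Prod>p\<in>P1. mgf (a p) (snd p)) * (\<Prod>p\<in>P2. mgf (a p) (snd p)) * (\<Prod>p\<in>P3. mgf (a p) (snd p))"
      using fin disj by (simp add: prod.union_disjoint)
    also have "(\<Prod>p\<in>P1. mgf (a p) (snd p)) = prod_list (map (weight \<alpha>) w)"
    proof -
      have "(\<Prod>p\<in>P1. mgf (a p) (snd p)) = (\<Prod>p\<in>P1. mgf (- \<alpha>) (snd p))"
        using a1 by (intro prod.cong) auto
      also have "\<dots> = (\<Prod>k\<in>{Suc 0..<Suc (length w)}. weight \<alpha> ((j # w) ! k))"
        unfolding P1_def prod_anc by (simp add: weight_def u_def)
      also have "\<dots> = prod_list (map (weight \<alpha>) w)"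
        by (subst prod.shift_bounds_Suc_ivl) (simp add: prod_list_map_nth atLeast0LessThan)
      finally show ?thesis .
    qed
    also have "(\<Prod>p\<in>P2. mgf (a p) (snd p)) = (\<Prod>i<k'. mgf (- \<alpha>) i) * (\<Prod>i\<in>{k'..<k' + n}. mgf (- \<alpha>) i)"
    proof -
      have "(\<Prod>p\<in>P2. mgf (a p) (snd p)) = (\<Prod>i\<in>{0..<k' + n}. mgf (- \<alpha>) i)"
        unfolding P2_def by (intro prod.reindex_bij_witness[of _ "Pair u" snd]) (auto simp: a_def u_def)
      then show ?thesis by (simp add: prod.atLeastLessThan_concat lessThan_atLeast0)
    qed
    also have "(\<Prod>p\<in>P3. mgf (a p) (snd p)) = (\<Prod>i\<in>{k'..<k' + n}. mgf \<alpha> i)"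
      unfolding P3_def by (intro prod.reindex_bij_witness[of _ "Pair []" snd]) (auto simp: a_def)
    finally have "(\<integral>\<^sup>+\<omega>. ennreal (exp (\<alpha> * (\<Sum>i<Suc n. D i \<omega>))) \<partial>M) =
        ennreal (exp (\<alpha> * real g)) * (\<Prod>i\<in>{k'..<k' + n}. factor \<alpha> i) *
        ((\<Prod>i<k'. mgf (- \<alpha>) i) * prod_list (map (weight \<alpha>) w))"
      by (simp add: factor_def prod.distrib mult_ac)
    also have "\<dots> \<le> ?C"
      by (intro mult_right_mono mult_left_mono prod_factor_le k') auto
    finally show ?thesis .
  qed
  have "{\<omega>\<in>space M. kid (rx \<omega>) [] K \<le> real g \<and> (\<exists>n\<ge>K. kid (rx \<omega>) (j # w) n < kid (rx \<omega>) [] n)} \<subseteq>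
      {\<omega>\<in>space M. \<exists>n. 0 < (\<Sum>i<Suc n. D i \<omega>)}"
  proof safe
    fix \<omega> n assume g: "kid (rx \<omega>) [] K \<le> real g" and n: "K \<le> n" "kid (rx \<omega>) (j # w) n < kid (rx \<omega>) [] n"
    have mono: "(\<Sum>i<a. x v i \<omega>) \<le> (\<Sum>i<b. x v i \<omega>)" if "a \<le> b" for a b v
      using that x_nonneg by (intro sum_mono2) auto
    have B'0: "0 \<le> B' \<omega>" using x_nonneg by (auto simp: B'_def intro!: sum_nonneg)
    have less: "(\<Sum>i<Suc j. x [] i \<omega>) + B' \<omega> + (\<Sum>i<n. x u i \<omega>) < (\<Sum>i<n. x [] i \<omega>)"
      using n(2) unfolding u_def[symmetric] kid_def birth_u by simp
    have "0 \<le> (\<Sum>i<n. x u i \<omega>)" using mono[of 0 n u] by simp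
    with less B'0 have "(\<Sum>i<Suc j. x [] i \<omega>) < (\<Sum>i<n. x [] i \<omega>)" by linarith
    \<comment> \<open>The root has to have produced the ancestor \<open>[j]\<close> before any
      descendant of it can be ahead.\<close>
    then have "Suc j \<le> n" using mono[of n "Suc j" "[]"] by (meson nat_le_linear not_le)
    with n have "k' \<le> n" by (simp add: k'_def k_def)
    then obtain m where m: "n = k' + m" using le_Suc_ex by blast
    \<comment> \<open>The part of the root's clock between the birth of \<open>[j]\<close> and its
      \<open>k'\<close>-th child: empty if \<open>K \<le> Suc j\<close>, and otherwise at most the
      birth time of the \<open>K\<close>-th child.\<close>
    have "(\<Sum>i<k'. x [] i \<omega>) - (\<Sum>i<Suc j. x [] i \<omega>) \<le> real g"
    proof (cases "K \<le> Suc j")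
      case True
      then show ?thesis by (simp add: k'_def k_def)
    next
      case False
      then have "k' = K" by (simp add: k'_def k_def)
      moreover have "0 \<le> (\<Sum>i<Suc j. x [] i \<omega>)" using mono[of 0 "Suc j" "[]"] by simp
      moreover have "(\<Sum>i<K. x [] i \<omega>) \<le> real g" using g by (simp add: kid_def)
      ultimately show ?thesis by simp
    qed
    moreover have "(\<Sum>i<n. x [] i \<omega>) = (\<Sum>i<k'. x [] i \<omega>) + (\<Sum>i\<in>{k'..<k' + m}. x [] i \<omega>)"
      by (simp add: m sum.atLeastLessThan_concat lessThan_atLeast0)
    ultimately have "0 < (\<Sum>i<Suc m. D i \<omega>)"
      using less unfolding sumD m by linarith
    then show "\<exists>n. 0 < (\<Sum>i<Suc n. D i \<omega>)" by blast
  qed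
  moreover have [measurable]: "D i \<in> borel_measurable M" for i
    using indep by (auto simp: indep_vars_def)
  ultimately have "emeasure M {\<omega>\<in>space M. kid (rx \<omega>) [] K \<le> real g \<and> (\<exists>n\<ge>K. kid (rx \<omega>) (j # w) n < kid (rx \<omega>) [] n)} \<le>
      emeasure M {\<omega>\<in>space M. \<exists>n. 0 < (\<Sum>i<Suc n. D i \<omega>)}"
    by (intro emeasure_mono) auto
  also have "\<dots> \<le> 2 * ?C" by (rule emeasure_exceeds_le[OF indep sym C])
  finally show ?thesis by (simp add: k'_def)
qed

lemma mgf_le_1: "mgf (- \<alpha>) i \<le> 1"
proof -
  have "mgf (- \<alpha>) i \<le> (\<integral>\<^sup>+\<omega>. 1 \<partial>M)"
    unfolding mgf_def using \<alpha> x_nonneg by (intro nn_integral_mono) auto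
  then show ?thesis by (simp add: emeasure_space_1)
qed

lemma AE_finite_overtakers:
  "AE \<omega> in M. finite {u. \<exists>n\<ge>K. kid (rx \<omega>) u n < kid (rx \<omega>) [] n}"
proof -
  let ?b = "SUP n. \<Prod>i\<in>{K..<n}. factor \<alpha> i"
  define c where "c j = (\<Prod>i<max (Suc j) K. mgf (- \<alpha>) i)" for j
  define C1 where "C1 = of_nat K + (\<Sum>j. weight \<alpha> j)"
  \<comment> \<open>For \<open>j \<ge> K\<close> this is the weight itself. For the \<open>K\<close>
    smaller letters the product runs up to \<open>K\<close> whatever \<open>j\<close> is, and the
    trivial bound 1 suffices as they are finitely many.\<close>
  have "c j \<le> (if j < K then 1 else 0) + weight \<alpha> j" for j
  proof (cases "j < K")
    case True
    have "(\<Prod>i\<in>I. mgf (- \<alpha>) i) \<le> 1" for I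
    proof (induction I rule: infinite_finite_induct)
      case (insert i I)
      then show ?case using mult_mono[OF mgf_le_1 insert.IH] by simp
    qed auto
    then show ?thesis using True by (simp add: c_def add_increasing2)
  next
    case False
    then show ?thesis by (simp add: c_def weight_def max_def lessThan_Suc_atMost)
  qed
  then have "(\<Sum>j\<in>J. c j) \<le> (\<Sum>j\<in>J. (if j < K then 1 else 0) + weight \<alpha> j)" if "finite J" for J
    by (intro sum_mono)
  moreover have "(\<Sum>j\<in>J. (if j < K then 1 else 0) + weight \<alpha> j) \<le> C1" if J: "finite J" for J
  proof -
    have "(\<Sum>j\<in>J. (if j < K then 1 else 0 :: ennreal)) = of_nat (card (J \<inter> {..<K}))"
      using J by (simp add: sum.If_cases lessThan_def)
    also have "\<dots> \<le> of_nat K"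
      using card_mono[of "{..<K}" "J \<inter> {..<K}"] by auto
    finally show ?thesis
      unfolding sum.distrib C1_def using J by (intro add_mono sum_le_suminf) auto
  qed
  ultimately have sum_c: "(\<Sum>j\<in>J. c j) \<le> C1" if "finite J" for J using that order_trans by blast
  have C1: "C1 < \<infinity>" using weight1 by (auto simp: C1_def ennreal_add_less_top of_nat_less_top intro: less_trans)
  obtain G where G: "G < \<infinity>" "\<And>F. finite F \<Longrightarrow> (\<Sum>w\<in>F. prod_list (map (weight \<alpha>) w)) \<le> G"
    using sum_prod_list_le[OF weight1] by blast
  define E where "E g u = {\<omega>\<in>space M. u \<noteq> [] \<and> kid (rx \<omega>) [] K \<le> real g \<and> (\<exists>n\<ge>K. kid (rx \<omega>) u n < kid (rx \<omega>) [] n)}"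
    for g :: nat and u
  have "AE \<omega> in M. finite {u. \<omega> \<in> E g u}" for g
  proof (rule AE_finite_if_sum_emeasure_le)
    show "E g u \<in> sets M" for u unfolding E_def by measurable
    let ?e = "ennreal (exp (\<alpha> * real g))"
    show "2 * (?e * ?b * (C1 * G)) < \<infinity>"
      using factors C1 G by (simp add: ennreal_mult_less_top)
    fix F :: "nat list set" assume F: "finite F"
    define F' where "F' = F - {[]}"
    have F': "finite F'" using F by (simp add: F'_def)
    let ?f = "\<lambda>w. prod_list (map (weight \<alpha>) w)"
    have "(\<Sum>u\<in>F. emeasure M (E g u)) = (\<Sum>u\<in>F'. emeasure M (E g u))"
      unfolding F'_def using F by (intro sum.mono_neutral_right) (auto simp: E_def)
    also have "\<dots> \<le> (\<Sum>u\<in>F'. 2 * (?e * ?b * (c (hd u) * ?f (tl u))))"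
    proof (intro sum_mono)
      fix u assume "u \<in> F'"
      then obtain j w where u: "u = j # w" by (cases u) (auto simp: F'_def)
      show "emeasure M (E g u) \<le> 2 * (?e * ?b * (c (hd u) * ?f (tl u)))"
        using emeasure_overtakes_root_le[of g j w] by (simp add: E_def u c_def)
    qed
    also have "\<dots> = 2 * (?e * ?b * (\<Sum>u\<in>F'. c (hd u) * ?f (tl u)))"
      by (simp add: sum_distrib_left)
    \<comment> \<open>Splitting off the first letter embeds the nonempty words into a rectangle,
      over which the sum factorizes.\<close>
    also have "(\<Sum>u\<in>F'. c (hd u) * ?f (tl u)) = (\<Sum>(j, w)\<in>(\<lambda>u. (hd u, tl u)) ` F'. c j * ?f w)"
      by (subst sum.reindex) (auto simp: inj_on_def F'_def intro: list.expand)
    also have "\<dots> \<le> (\<Sum>(j, w)\<in>hd ` F' \<times> tl ` F'. c j * ?f w)"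
      using F' by (intro sum_mono2) auto
    also have "\<dots> = (\<Sum>j\<in>hd ` F'. c j) * (\<Sum>w\<in>tl ` F'. ?f w)"
      by (simp add: sum.cartesian_product[symmetric] sum_product)
    also have "\<dots> \<le> C1 * G" using F' by (intro mult_mono sum_c G) auto
    finally show "(\<Sum>u\<in>F. emeasure M (E g u)) \<le> 2 * (?e * ?b * (C1 * G))"
      by (simp add: mult_left_mono)
  qed
  then have "AE \<omega> in M. \<forall>g. finite {u. \<omega> \<in> E g u}"
    by (subst AE_all_countable) auto
  then show ?thesis
    using AE_space
  proof eventually_elim
    case (elim \<omega>)
    obtain g :: nat where "kid (rx \<omega>) [] K \<le> real g" using real_arch_simple by blast
    then have "{u. \<exists>n\<ge>K. kid (rx \<omega>) u n < kid (rx \<omega>) [] n} \<subseteq> {u. \<omega> \<in> E g u}"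
      using elim(2) by (auto simp: E_def)
    then show ?case using elim(1) finite_subset by blast
  qed
qed

lemma AE_persistent_hub:
  "AE \<omega> in M. has_persistent_hub
    (\<lambda>n. cmj_tree (\<lambda>u j. ennreal (x u j \<omega>)) (cmj_tau (\<lambda>u j. ennreal (x u j \<omega>)) n))"
proof -
  have "AE \<omega> in M. \<forall>t. finite {w \<in> lists UNIV. rbirth (rx \<omega>) w \<le> t}"
    using \<alpha> weight1 by (intro AE_finite_truncated_tree[of \<alpha>]) auto
  moreover have "AE \<omega> in M. \<forall>u v. (\<forall>\<^sub>F n in sequentially. kid (rx \<omega>) u n \<le> kid (rx \<omega>) v n) \<or>
               (\<forall>\<^sub>F n in sequentially. kid (rx \<omega>) v n \<le> kid (rx \<omega>) u n)"
    unfolding AE_all_countable using AE_eventually_comparable by blast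
  ultimately show ?thesis
    using AE_finite_overtakers
  proof eventually_elim
    case (elim \<omega>)
    show ?case
    proof (rule has_persistent_hub_if[of "rx \<omega>" "{u. \<exists>n\<ge>K. kid (rx \<omega>) u n < kid (rx \<omega>) [] n}" K])
      show "finite {w. rbirth (rx \<omega>) w \<le> t}" for t using elim(1) by simp
    qed (use elim(2,3) x_nonneg in \<open>auto simp: not_less[symmetric]\<close>)
  qed
qed

end

end

text \<open>All waiting times are almost surely finite, so passing to \<open>enn2real\<close>
  changes the process only on a null set. The rows of any two distinct nodes have joint law
  \<open>L \<Otimes>\<^sub>M L\<close> and serve as the sequence and its independent copy. Counting
  children from 0 makes the product start at \<open>K\<close>.\<close>

theorem theorem2p4:
  fixes M :: "'a measure" and X :: "nat list \<Rightarrow> nat \<Rightarrow> 'a \<Rightarrow> ennreal"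
  defines "L \<equiv> distr M (PiM UNIV (\<lambda>_. borel)) (\<lambda>\<omega> j. X [] j \<omega>)"
  assumes prob: "prob_space M"
    and meas: "\<And>u j. X u j \<in> borel_measurable M"
    and indep_nodes: "prob_space.indep_vars M (\<lambda>_. PiM UNIV (\<lambda>_. borel)) (\<lambda>u \<omega> j. X u j \<omega>) UNIV"
    and ident: "\<And>u. distr M (PiM UNIV (\<lambda>_. borel)) (\<lambda>\<omega> j. X u j \<omega>) = L"
    and A1: "prob_space.indep_vars M (\<lambda>_. borel) (\<lambda>j. X [] j) UNIV"
    and A2: "\<And>j. AE \<omega> in M. X [] j \<omega> < \<infinity>"
    and A3: "(\<Sum>j. \<Prod>i\<le>j. emeasure M {\<omega>\<in>space M. X [] i \<omega> = 0}) < 1"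
  shows
    "((AE xy in L \<Otimes>\<^sub>M L. \<not> summable (\<lambda>i. enn2real (fst xy i) - enn2real (snd xy i)))
        \<longrightarrow> (AE \<omega> in M. \<not> has_persistent_hub
               (\<lambda>n. cmj_tree (\<lambda>u j. X u j \<omega>) (cmj_tau (\<lambda>u j. X u j \<omega>) n))))
     \<and> (\<forall>(\<alpha>::real) (K::nat). \<alpha> > 0 \<and> K \<ge> 1
        \<and> (\<Sum>j. \<integral>\<^sup>+ \<omega>. ennreal (exp (- \<alpha> * (\<Sum>i\<le>j. enn2real (X [] i \<omega>)))) \<partial>M) < 1
        \<and> (SUP n. \<Prod>i\<in>{K..<n}.
             \<integral>\<^sup>+ xy. ennreal (exp (\<alpha> * (enn2real (snd xy i) - enn2real (fst xy i)))) \<partial>(L \<Otimes>\<^sub>M L)) < \<infinity>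
        \<longrightarrow> (AE \<omega> in M. has_persistent_hub
               (\<lambda>n. cmj_tree (\<lambda>u j. X u j \<omega>) (cmj_tau (\<lambda>u j. X u j \<omega>) n))))"
proof -
  interpret prob_space M by (rule prob)
  note [measurable] = meas
  define x where "x u j \<omega> = enn2real (X u j \<omega>)" for u j \<omega>
  have seq [measurable]: "(\<lambda>\<omega> j. X u j \<omega>) \<in> measurable M (PiM UNIV (\<lambda>_. borel))" for u
    by (intro measurable_PiM_single') auto
  have identX: "distr M borel (X u j) = distr M borel (X [] j)" for u j
  proof -
    have "distr M borel (X u j) = distr (distr M (PiM UNIV (\<lambda>_. borel)) (\<lambda>\<omega> j. X u j \<omega>)) borel (\<lambda>f. f j)" for u
      by (subst distr_distr) (auto simp: comp_def)
    then show ?thesis by (simp only: ident)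
  qed
  have pairs: "indep_vars (\<lambda>_. borel) (\<lambda>p. X (fst p) (snd p)) UNIV"
    by (rule indep_vars_pairs[OF meas indep_nodes _ A1]) (simp add: ident)
  interpret waiting_times M x
  proof
    show "0 \<le> x u j \<omega>" for u j \<omega> by (simp add: x_def)
    show "indep_vars (\<lambda>_. borel) (\<lambda>p. x (fst p) (snd p)) UNIV"
      unfolding x_def by (rule indep_vars_compose2[OF pairs]) auto
    have "distr M borel (x u j) = distr (distr M borel (X u j)) borel enn2real" for u j
      by (subst distr_distr) (auto simp: comp_def x_def[abs_def])
    then show "distr M borel (x u j) = distr M borel (x [] j)" for u j
      by (simp only: identX[of u j])
  qed
  have fin: "AE \<omega> in M. X u j \<omega> < \<infinity>" for u j
  proof -
    have "AE y in distr M borel (X [] j). y < \<infinity>" using A2 by (subst AE_distr_iff) auto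
    then have "AE y in distr M borel (X u j). y < \<infinity>" by (simp only: identX[of u j])
    then show ?thesis by (subst (asm) AE_distr_iff) auto
  qed
  have "AE \<omega> in M. X u j \<omega> = ennreal (x u j \<omega>)" for u j
    using fin[of u j] by eventually_elim (simp add: x_def)
  then have Xx: "AE \<omega> in M. (\<lambda>u j. X u j \<omega>) = (\<lambda>u j. ennreal (x u j \<omega>))"
    by (simp add: fun_eq_iff AE_all_countable)
  have pairL: "L \<Otimes>\<^sub>M L = distr M (PiM UNIV (\<lambda>_. borel) \<Otimes>\<^sub>M PiM UNIV (\<lambda>_. borel)) (\<lambda>\<omega>. (\<lambda>j. X u j \<omega>, \<lambda>j. X v j \<omega>))"
    if "u \<noteq> v" for u v
  proof -
    have "inj (case_bool u v)" using that by (auto simp: inj_def split: bool.splits)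
    from indep_vars_inj_reindex[OF indep_nodes this]
    have "indep_var (PiM UNIV (\<lambda>_. borel)) (\<lambda>\<omega> j. X u j \<omega>) (PiM UNIV (\<lambda>_. borel)) (\<lambda>\<omega> j. X v j \<omega>)"
      unfolding indep_var_def by (rule indep_vars_cong[THEN iffD1, rotated -1]) (auto split: bool.split)
    then show ?thesis by (simp add: indep_var_distribution_eq ident)
  qed
  show ?thesis
  proof (intro conjI impI allI)
    assume div: "AE xy in L \<Otimes>\<^sub>M L. \<not> summable (\<lambda>i. enn2real (fst xy i) - enn2real (snd xy i))"
    have "AE \<omega> in M. \<not> has_persistent_hub
        (\<lambda>n. cmj_tree (\<lambda>u j. ennreal (x u j \<omega>)) (cmj_tau (\<lambda>u j. ennreal (x u j \<omega>)) n))"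
    proof (rule AE_no_persistent_hub)
      fix m
      have "emeasure M {\<omega>\<in>space M. X [] i \<omega> = 0} = ennreal (\<P>(\<omega> in M. x [] i \<omega> = 0))" for i
      proof -
        \<comment> \<open>\<open>enn2real\<close> also sends infinity to 0, so the two events agree
          only up to the null set of infinite waiting times.\<close>
        have "emeasure M {\<omega>\<in>space M. X [] i \<omega> = 0} = emeasure M {\<omega>\<in>space M. x [] i \<omega> = 0}"
          using A2[of i] by (intro emeasure_eq_AE) (auto simp: x_def enn2real_eq_0_iff)
        then show ?thesis by (simp add: emeasure_eq_measure)
      qed
      then have "ennreal (\<Sum>j<m. \<Prod>i\<le>j. \<P>(\<omega> in M. x [] i \<omega> = 0)) =
          (\<Sum>j<m. \<Prod>i\<le>j. emeasure M {\<omega>\<in>space M. X [] i \<omega> = 0})"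
        by (subst sum_ennreal[symmetric]) (auto simp: prod_ennreal intro!: prod_nonneg)
      also have "\<dots> \<le> (\<Sum>j. \<Prod>i\<le>j. emeasure M {\<omega>\<in>space M. X [] i \<omega> = 0})"
        by (intro sum_le_suminf) auto
      also have "\<dots> < 1" by (rule A3)
      finally show "(\<Sum>j<m. \<Prod>i\<le>j. \<P>(\<omega> in M. x [] i \<omega> = 0)) < 1"
        by (simp add: ennreal_less_one_iff)
    next
      fix u v :: "nat list" assume "u \<noteq> v"
      have "AE \<omega> in M. \<not> summable (\<lambda>i. enn2real (fst (\<lambda>j. X u j \<omega>, \<lambda>j. X v j \<omega>) i) -
          enn2real (snd (\<lambda>j. X u j \<omega>, \<lambda>j. X v j \<omega>) i))"
        by (rule AE_distrD[OF _ div[unfolded pairL[OF \<open>u \<noteq> v\<close>]]]) measurable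
      then show "AE \<omega> in M. \<not> summable (\<lambda>j. x u j \<omega> - x v j \<omega>)" by (simp add: x_def)
    qed
    with Xx show "AE \<omega> in M. \<not> has_persistent_hub
        (\<lambda>n. cmj_tree (\<lambda>u j. X u j \<omega>) (cmj_tau (\<lambda>u j. X u j \<omega>) n))"
      by eventually_elim simp
  next
    fix \<alpha> :: real and K :: nat
    assume *: "\<alpha> > 0 \<and> K \<ge> 1
        \<and> (\<Sum>j. \<integral>\<^sup>+ \<omega>. ennreal (exp (- \<alpha> * (\<Sum>i\<le>j. enn2real (X [] i \<omega>)))) \<partial>M) < 1
        \<and> (SUP n. \<Prod>i\<in>{K..<n}.
             \<integral>\<^sup>+ xy. ennreal (exp (\<alpha> * (enn2real (snd xy i) - enn2real (fst xy i)))) \<partial>(L \<Otimes>\<^sub>M L)) < \<infinity>"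
    have "(\<integral>\<^sup>+ xy. ennreal (exp (\<alpha> * (enn2real (snd xy i) - enn2real (fst xy i)))) \<partial>(L \<Otimes>\<^sub>M L)) = factor \<alpha> i" for i
    proof -
      have "(\<integral>\<^sup>+ xy. ennreal (exp (\<alpha> * (enn2real (snd xy i) - enn2real (fst xy i)))) \<partial>(L \<Otimes>\<^sub>M L)) =
          (\<integral>\<^sup>+\<omega>. ennreal (exp (\<alpha> * (x [0] i \<omega> - x [] i \<omega>))) \<partial>M)"
        \<comment> \<open>The root plays the unprimed sequence and its first child the copy; any
          other pair of distinct nodes would give the same value.\<close>
        by (subst pairL[of "[]" "[0]"], simp, subst nn_integral_distr) (auto simp: x_def)
      then show ?thesis by (simp add: nn_integral_exp_diff)
    qed
    with * have "AE \<omega> in M. has_persistent_hub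
        (\<lambda>n. cmj_tree (\<lambda>u j. ennreal (x u j \<omega>)) (cmj_tau (\<lambda>u j. ennreal (x u j \<omega>)) n))"
      by (intro AE_persistent_hub[of \<alpha> K]) (simp_all add: weight_eq[symmetric] x_def)
    with Xx show "AE \<omega> in M. has_persistent_hub
        (\<lambda>n. cmj_tree (\<lambda>u j. X u j \<omega>) (cmj_tau (\<lambda>u j. X u j \<omega>) n))"
      by eventually_elim simp
  qed
qed

end
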